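(* In the setting with common parameters described in the context, suppose that (1) $\mathbf Q=\gamma\mathbf X'\mathbf X$ for some $\gamma>0$; (2) for some fixed $b>0$ (the same for all models) the posterior means of $\boldsymbol\beta_{\mathbf l}$ are of the form $\widetilde{\boldsymbol\beta}_{\mathbf l}=b(\mathbf X_{\mathbf l}'\mathbf Q_{(1)}\mathbf X_{\mathbf l})^{-1}\mathbf X_{\mathbf l}'\mathbf Q_{(1)}\mathbf y$; (3) $\pi_{\mathbf l}(\boldsymbol\beta_{(1)},\boldsymbol\beta_{\mathbf l}|\sigma)=\pi_{\mathbf l}(\boldsymbol\beta_{\mathbf l}|\sigma)$, i.e. the prior density for $\boldsymbol\beta_{(1)}$ in each model is constant; and that $\mathbf X_{(2)}'\mathbf Q_{(1)}\mathbf X_{(2)}$ is diagonal with positive entries, where the full design matrix is $\mathbf X=(\mathbf X_{(1)}\ \mathbf X_{(2)})$. Then, if the class of models under consideration has graphical model structure, the best predictive model is the median probability model $M_{\mathbf l^*}$, where $l_i^*=1$ if $p_i\ge\frac12$ and $l_i^*=0$ otherwise.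
   Context: Setting with common parameters. The full model is $\mathbf y=\mathbf X\boldsymbol\beta+\boldsymbol\varepsilon$, with $\mathbf y\in\mathbb R^n$ observed, $\mathbf X=(\mathbf X_{(1)}\ \mathbf X_{(2)})$ an $n\times k$ ($k<n$) matrix of full rank, $\mathbf X_{(1)}$ being $n\times k_1$ and $\mathbf X_{(2)}$ being $n\times k_2$, $k_1+k_2=k$, and $\boldsymbol\varepsilon$ having independent $N(0,\sigma^2)$ coordinates ($\sigma^2$ known or unknown). All models contain the common parameters $\boldsymbol\beta_{(1)}=(\beta_1,\dots,\beta_{k_1})'$. Models are indexed by $\mathbf l\in\{0,1\}^{k_2}$, recording which of the remaining (noncommon) variables are included: $M_{\mathbf l}$ is $\mathbf y=\mathbf X_{(1)}\boldsymbol\beta_{(1)}+\mathbf X_{\mathbf l}\boldsymbol\beta_{\mathbf l}+\boldsymbol\varepsilon$, where $\mathbf X_{\mathbf l}$ consists of the columns $i$ of $\mathbf X_{(2)}$ with $l_i=1$. With $k_{\mathbf l}=\sum_i l_i$, $\mathbf H_{\mathbf l}$ is the $k_2\times k_{\mathbf l}$ matrix whose $(i,j)$ entry is $1$ if $l_i=1$ and $j=\sum_{r=1}^i l_r$, and $0$ otherwise, so $\mathbf X_{\mathbf l}=\mathbf X_{(2)}\mathbf H_{\mathbf l}$. Put $$\mathbf Q_{(1)}=\mathbf I-\mathbf X_{(1)}(\mathbf X_{(1)}'\mathbf X_{(1)})^{-1}\mathbf X_{(1)}'.$$ Posterior inputs: for each model under consideration a posterior probability $p_{\mathbf l}=P(M_{\mathbf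 l}|\mathbf y)\ge0$ with $\sum_{\mathbf l}p_{\mathbf l}=1$ (sums over $\mathbf l$ are over the class under consideration), and a posterior distribution $\pi_{\mathbf l}(\boldsymbol\beta_{(1)},\boldsymbol\beta_{\mathbf l},\sigma|\mathbf y)$ obtained by Bayes' theorem within $M_{\mathbf l}$ from the normal likelihood and the (possibly improper) prior $\pi_{\mathbf l}(\boldsymbol\beta_{(1)},\boldsymbol\beta_{\mathbf l}|\sigma)$, combined with a prior on $\sigma$ if $\sigma$ is unknown; it is proper with posterior means $\widetilde{\boldsymbol\beta}_{(1),\mathbf l}$ of $\boldsymbol\beta_{(1)}$ and $\widetilde{\boldsymbol\beta}_{\mathbf l}$ of $\boldsymbol\beta_{\mathbf l}$. (The $p_{\mathbf l}$ may be determined separately from these posteriors.) Prediction: for a future covariate row vector $\mathbf x^*=(\mathbf x^*_{(1)},\mathbf x^*_{(2)})$, random with $\mathbf Q=\mathbf E[(\mathbf x^* )'(\mathbf x^* )]$ existing and positive definite, the future $y^*=\mathbf x^*\boldsymbol\beta+\varepsilon$ is predicted under squared error loss; the predictor under $M_{\mathbf l}$ is $\widehat y^*_{\mathbf l}=\mathbf x^*_{(1)}\widetilde{\boldsymbol\beta}_{(1),\mathbf l}+\mathbf x^*_{(2)}\mathbf H_{\mathbf l}\widetilde{\boldsymbol\beta}_{\mathbf l}$, and $\bar y^*=\sum_{\mathbf l}p_{\mathbf l}\widehat y^*_{\mathbf l}$. The best predictive model is the model under consideration minimizing $R(M_{\mathbf l})=\mathbf E^{\mathbf x^*}[(\widehat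 y^*_{\mathbf l}-\bar y^* )^2]$ (equivalently, minimizing the posterior expected predictive squared error loss, which differs from $R(M_{\mathbf l})$ by a constant not depending on $\mathbf l$). The posterior inclusion probability of noncommon variable $i$ is $p_i=\sum_{\mathbf l:\,l_i=1}p_{\mathbf l}$ (common variables are in every model, so have inclusion probability $1$ and are always in the median probability model). Graphical model structure: the class has graphical model structure if there are, for each variable $i$, index sets $I(i)$ of other variables such that the class consists of all models satisfying: for each $i$, if variable $x_i$ is in the model, then the variables $x_j$ with $j\in I(i)$ are in the model. *)

theory Defs
  imports
    "HOL-Probability.Probability"
    "Jordan_Normal_Form.Gauss_Jordan_Elimination"
    "Jordan_Normal_Form.DL_Rank"
begin

unbundle no vec_syntax and no inner_syntax

text \<open>Coordinates are numbered from 0. A model is its 0/1 inclusion vector over the noncommon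
  variables.\<close>

definition models :: "nat \<Rightarrow> nat vec set" where
  "models k2 = {l \<in> carrier_vec k2. \<forall>i<k2. l $ i \<in> {0, 1}}"

definition model_size :: "nat vec \<Rightarrow> nat" where
  "model_size l = (\<Sum>i<dim_vec l. l $ i)"

text \<open>Because columns are numbered from 0, column \<open>j\<close> is matched with the \<open>(j + 1)\<close>-st
  included variable.\<close>

definition selection_mat :: "nat vec \<Rightarrow> real mat" where
  "selection_mat l = mat (dim_vec l) (model_size l)
     (\<lambda>(i, j). if l $ i = 1 \<and> j + 1 = (\<Sum>r\<le>i. l $ r) then 1 else 0)"

definition sub_design :: "real mat \<Rightarrow> nat vec \<Rightarrow> real mat" where
  "sub_design X2 l = X2 * selection_mat l"

definition full_design :: "real mat \<Rightarrow> real mat \<Rightarrow> real mat" where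
  "full_design X1 X2 = mat_of_cols (dim_row X1) (cols X1 @ cols X2)"

text \<open>Meaningful for invertible matrices only.\<close>

definition inv_mat :: "real mat \<Rightarrow> real mat" where
  "inv_mat A = the (mat_inverse A)"

definition residual_proj :: "real mat \<Rightarrow> real mat" where
  "residual_proj X1 =
     1\<^sub>m (dim_row X1) - X1 * inv_mat (transpose_mat X1 * X1) * transpose_mat X1"

text \<open>The variables are numbered \<open>0, \<dots>, k1 + k2 - 1\<close>, the common ones coming first.\<close>

definition model_variables :: "nat \<Rightarrow> nat vec \<Rightarrow> nat set" where
  "model_variables k1 l = {..<k1} \<union> {k1 + i | i. i < dim_vec l \<and> l $ i = 1}"

definition graphical_structure :: "nat \<Rightarrow> nat \<Rightarrow> nat vec set \<Rightarrow> bool" where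
  "graphical_structure k1 k2 L \<longleftrightarrow>
     (\<exists>I :: nat \<Rightarrow> nat set.
        (\<forall>i < k1 + k2. I i \<subseteq> {..< k1 + k2} - {i}) \<and>
        L = {l \<in> models k2. \<forall>i < k1 + k2.
               i \<in> model_variables k1 l \<longrightarrow> I i \<subseteq> model_variables k1 l})"

text \<open>Lebesgue measure on the space \<open>carrier_vec d\<close>; for \<open>d = 0\<close> it is the unit mass at the
  empty vector.\<close>

definition lborel_vec :: "nat \<Rightarrow> real vec measure" where
  "lborel_vec d = embed_measure (Pi\<^sub>M {..<d} (\<lambda>_. lborel)) (vec d)"

text \<open>The prior on the standard deviation: a measure on the positive reals, possibly improper.
  A known standard deviation \<open>\<sigma>\<close> is the case \<open>return borel \<sigma>\<close>.\<close>

definition sd_prior :: "real measure \<Rightarrow> bool" where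
  "sd_prior S \<longleftrightarrow>
     sets S = sets borel \<and> sigma_finite_measure S \<and> emeasure S {..0} = 0"

definition likelihood ::
  "real mat \<Rightarrow> real mat \<Rightarrow> real vec \<Rightarrow> real vec \<Rightarrow> real vec \<Rightarrow> real \<Rightarrow> real" where
  "likelihood X1 Xl y b1 bl s =
     (\<Prod>i<dim_vec y. normal_density ((X1 *\<^sub>v b1 + Xl *\<^sub>v bl) $ i) s (y $ i))"

text \<open>Parameters \<open>(b1, bl, s)\<close> of a model: common coefficients, noncommon coefficients, standard
  deviation. The prior of the coefficients given \<open>s\<close> is a density \<open>\<pi> b1 bl s\<close> with respect to
  Lebesgue measure. Since \<open>S\<close> may be a point mass, densities of the full parameter are taken with
  respect to the product of Lebesgue measure and \<open>S\<close>.\<close>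

definition param_measure ::
  "real mat \<Rightarrow> real mat \<Rightarrow> real measure \<Rightarrow> (real vec \<times> real vec \<times> real) measure" where
  "param_measure X1 Xl S =
     lborel_vec (dim_col X1) \<Otimes>\<^sub>M (lborel_vec (dim_col Xl) \<Otimes>\<^sub>M S)"

definition marginal_likelihood ::
  "real mat \<Rightarrow> real mat \<Rightarrow> real vec \<Rightarrow> (real vec \<Rightarrow> real vec \<Rightarrow> real \<Rightarrow> real) \<Rightarrow> real measure \<Rightarrow> ennreal"
where
  "marginal_likelihood X1 Xl y \<pi> S =
     (\<integral>\<^sup>+ (b1, bl, s). ennreal (likelihood X1 Xl y b1 bl s * \<pi> b1 bl s) \<partial>param_measure X1 Xl S)"

definition posterior ::
  "real mat \<Rightarrow> real mat \<Rightarrow> real vec \<Rightarrow> (real vec \<Rightarrow> real vec \<Rightarrow> real \<Rightarrow> real) \<Rightarrow> real measure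
     \<Rightarrow> (real vec \<times> real vec \<times> real) measure"
where
  "posterior X1 Xl y \<pi> S = density (param_measure X1 Xl S)
     (\<lambda>(b1, bl, s). ennreal (likelihood X1 Xl y b1 bl s * \<pi> b1 bl s)
                      / marginal_likelihood X1 Xl y \<pi> S)"

definition prior_density ::
  "real mat \<Rightarrow> real mat \<Rightarrow> (real vec \<Rightarrow> real vec \<Rightarrow> real \<Rightarrow> real) \<Rightarrow> real measure \<Rightarrow> bool" where
  "prior_density X1 Xl \<pi> S \<longleftrightarrow>
     (\<lambda>(b1, bl, s). \<pi> b1 bl s) \<in> borel_measurable (param_measure X1 Xl S) \<and>
     (\<forall>b1 \<in> carrier_vec (dim_col X1). \<forall>bl \<in> carrier_vec (dim_col Xl). \<forall>s > 0. 0 \<le> \<pi> b1 bl s)"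

definition proper_posterior ::
  "real mat \<Rightarrow> real mat \<Rightarrow> real vec \<Rightarrow> (real vec \<Rightarrow> real vec \<Rightarrow> real \<Rightarrow> real) \<Rightarrow> real measure \<Rightarrow> bool"
where
  "proper_posterior X1 Xl y \<pi> S \<longleftrightarrow>
     0 < marginal_likelihood X1 Xl y \<pi> S \<and> marginal_likelihood X1 Xl y \<pi> S < \<infinity>"

definition has_coefficient_means ::
  "nat \<Rightarrow> nat \<Rightarrow> (real vec \<times> real vec \<times> real) measure \<Rightarrow> bool" where
  "has_coefficient_means d1 d2 M \<longleftrightarrow>
     (\<forall>i<d1. integrable M (\<lambda>(b1, bl, s). b1 $ i)) \<and>
     (\<forall>j<d2. integrable M (\<lambda>(b1, bl, s). bl $ j))"

definition mean_common :: "nat \<Rightarrow> (real vec \<times> real vec \<times> real) measure \<Rightarrow> real vec" where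
  "mean_common d1 M = vec d1 (\<lambda>i. \<integral>(b1, bl, s). b1 $ i \<partial>M)"

definition mean_noncommon :: "nat \<Rightarrow> (real vec \<times> real vec \<times> real) measure \<Rightarrow> real vec" where
  "mean_noncommon d2 M = vec d2 (\<lambda>j. \<integral>(b1, bl, s). bl $ j \<partial>M)"

definition second_moments :: "'w measure \<Rightarrow> nat \<Rightarrow> ('w \<Rightarrow> real vec) \<Rightarrow> real mat" where
  "second_moments P k x = mat k k (\<lambda>(i, j). \<integral>\<omega>. x \<omega> $ i * x \<omega> $ j \<partial>P)"

definition pos_def_mat :: "real mat \<Rightarrow> bool" where
  "pos_def_mat A \<longleftrightarrow>
     transpose_mat A = A \<and>
     (\<forall>v \<in> carrier_vec (dim_row A). v \<noteq> 0\<^sub>v (dim_row A) \<longrightarrow> 0 < v \<bullet> (A *\<^sub>v v))"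

text \<open>Below, \<open>bt1 l\<close> and \<open>bt l\<close> are the posterior means of the common and the noncommon
  coefficients in model \<open>l\<close>, and \<open>p l\<close> is the posterior probability of model \<open>l\<close>.\<close>

definition predictor ::
  "(nat vec \<Rightarrow> real vec) \<Rightarrow> (nat vec \<Rightarrow> real vec) \<Rightarrow> nat vec \<Rightarrow> real vec \<Rightarrow> real" where
  "predictor bt1 bt l x =
     vec_first x (dim_vec (bt1 l)) \<bullet> bt1 l + vec_last x (dim_vec l) \<bullet> (selection_mat l *\<^sub>v bt l)"

definition averaged_predictor ::
  "nat vec set \<Rightarrow> (nat vec \<Rightarrow> real) \<Rightarrow> (nat vec \<Rightarrow> real vec) \<Rightarrow> (nat vec \<Rightarrow> real vec)
     \<Rightarrow> real vec \<Rightarrow> real" where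
  "averaged_predictor L p bt1 bt x = (\<Sum>l\<in>L. p l * predictor bt1 bt l x)"

definition predictive_risk ::
  "'w measure \<Rightarrow> ('w \<Rightarrow> real vec) \<Rightarrow> nat vec set \<Rightarrow> (nat vec \<Rightarrow> real)
     \<Rightarrow> (nat vec \<Rightarrow> real vec) \<Rightarrow> (nat vec \<Rightarrow> real vec) \<Rightarrow> nat vec \<Rightarrow> real" where
  "predictive_risk P x L p bt1 bt l =
     (\<integral>\<omega>. (predictor bt1 bt l (x \<omega>) - averaged_predictor L p bt1 bt (x \<omega>))\<^sup>2 \<partial>P)"

text \<open>Minimisers need not be unique.\<close>

definition best_predictive_model ::
  "'w measure \<Rightarrow> ('w \<Rightarrow> real vec) \<Rightarrow> nat vec set \<Rightarrow> (nat vec \<Rightarrow> real)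
     \<Rightarrow> (nat vec \<Rightarrow> real vec) \<Rightarrow> (nat vec \<Rightarrow> real vec) \<Rightarrow> nat vec \<Rightarrow> bool" where
  "best_predictive_model P x L p bt1 bt l \<longleftrightarrow>
     is_arg_min (predictive_risk P x L p bt1 bt) (\<lambda>l'. l' \<in> L) l"

definition inclusion_prob :: "nat vec set \<Rightarrow> (nat vec \<Rightarrow> real) \<Rightarrow> nat \<Rightarrow> real" where
  "inclusion_prob L p i = (\<Sum>l\<in>{l\<in>L. l $ i = 1}. p l)"

definition median_probability_model ::
  "nat \<Rightarrow> nat vec set \<Rightarrow> (nat vec \<Rightarrow> real) \<Rightarrow> nat vec" where
  "median_probability_model k2 L p = vec k2 (\<lambda>i. if inclusion_prob L p i \<ge> 1/2 then 1 else 0)"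

end

theory Submission
  imports Defs
begin

text \<open>
  The proof turns the predictive risk into a sum with one term for each noncommon variable, which the
  median probability model minimizes term by term.

  The flat prior makes the posterior symmetric in the common coefficients: for given noncommon
  coefficients \<open>bl\<close>, both the likelihood and Lebesgue measure are invariant under reflection at the
  least squares fit of \<open>X1\<close> to the response \<open>y - Xl *\<^sub>v bl\<close>. Hence the posterior mean of the common
  coefficients is that fit at the posterior mean of \<open>bl\<close> (\<open>mean_common_eq_least_squares\<close>).

  Since the second moments of the covariates are $\gamma X'X$, the risk is $\gamma$ times the squared
  distance between the fitted values of the model and the averaged ones. With the common
  coefficients as just described, this distance is the norm of the part of $X_{(2)} d$ orthogonal to
  the columns of $X_{(1)}$, where $d$ is the difference of the noncommon coefficients. As
  $X_{(2)}' Q_{(1)} X_{(2)}$ is diagonal with entries $g_i$, the risk is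
  $\gamma \sum_i g_i d_i^2$ (\<open>predictive_risk_eq_weighted_squares\<close>).

  The same orthogonality makes the coefficient of variable $i$ equal to one number $a_i$ in all models
  that contain it and zero in the others (\<open>noncommon_coefficients_index\<close>), so that its average is
  $p_i a_i$. Therefore the risk of the model $l$ is $\gamma \sum_i g_i a_i^2 (l_i - p_i)^2$, and rounding each
  $p_i$ to 0 or 1 is optimal among all 0/1 vectors. The resulting model belongs to the class because
  an implied variable is at least as probable as the variable that implies it
  (\<open>median_probability_model_in_class\<close>).
\<close>

section \<open>Matrix inverses and selection matrices\<close>

lemma mult_mat_assoc:
  fixes A B C :: "real mat"
  assumes "dim_col A = dim_row B" "dim_col B = dim_row C"
  shows "(A * B) * C = A * (B * C)"
  using assms by (intro assoc_mult_mat[of _ _ "dim_row B" _ "dim_row C" _ "dim_col C"]) auto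

lemma mult_mat_vec_assoc:
  fixes A B :: "real mat"
  assumes "dim_col A = dim_row B" "dim_col B = dim_vec v"
  shows "(A * B) *\<^sub>v v = A *\<^sub>v (B *\<^sub>v v)"
  using assms by (intro assoc_mult_mat_vec[of _ _ "dim_row B" _ "dim_vec v"]) auto

text \<open>Associativity carries carrier premises with a dimension that does not occur in the equation, so
  that the simplifier can search for it forever. The two variants above have premises on dimensions,
  which simplification decides.\<close>

declare assoc_mult_mat [simp del] assoc_mult_mat_vec [simp del]

lemma modelsD:
  assumes "l \<in> models k2"
  shows "dim_vec l = k2" "l \<in> carrier_vec k2" "\<And>i. i < k2 \<Longrightarrow> l $ i = 0 \<or> l $ i = 1"
  using assms by (auto simp: models_def)

lemma selection_mat_carrier: "selection_mat l \<in> carrier_mat (dim_vec l) (model_size l)"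
  by (simp add: selection_mat_def)

text \<open>The partial sums of a 0/1 vector increase by one exactly at the included indices, so they number
  these indices consecutively. This is why the selection matrix has one entry 1 in each column.\<close>

lemma bij_betw_selected_column:
  assumes l: "l \<in> models k2"
  shows "bij_betw (\<lambda>i. (\<Sum>r\<le>i. l $ r) - 1) {i \<in> {..<k2}. l $ i = 1} {..<model_size l}"
proof -
  let ?c = "\<lambda>i. \<Sum>r\<le>i. l $ r" and ?S = "{i \<in> {..<k2}. l $ i = 1}"
  note ld = modelsD[OF l]
  have pos: "1 \<le> ?c i" if "i \<in> ?S" for i
    using that member_le_sum[of i "{..i}" "\<lambda>r. l $ r"] by auto
  have less: "?c i < ?c j" if "i < j" "j \<in> ?S" for i j
  proof -
    have "?c i + l $ j = (\<Sum>r\<in>insert j {..i}. l $ r)" using that by simp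
    also have "\<dots> \<le> ?c j" using that by (intro sum_mono2) auto
    finally show ?thesis using that by simp
  qed
  (* Subtraction of natural numbers truncates, so injectivity needs the sums to be positive. *)
  have inj: "inj_on (\<lambda>i. ?c i - 1) ?S"
  proof (rule inj_onI)
    fix i j assume ij: "i \<in> ?S" "j \<in> ?S" "?c i - 1 = ?c j - 1"
    then have "?c i = ?c j" using pos[of i] pos[of j] by simp
    then show "i = j" using less[of i j] less[of j i] ij by (metis less_irrefl linorder_neqE_nat)
  qed
  have size: "model_size l = card ?S"
  proof -
    have "model_size l = (\<Sum>i<k2. if l $ i = 1 then 1 else 0)"
      unfolding model_size_def ld(1) using ld(3) by (intro sum.cong) fastforce+
    also have "\<dots> = card ?S"
      by (simp only: card_eq_sum sum.inter_filter[symmetric] finite_lessThan)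
    finally show ?thesis .
  qed
  have ran: "(\<lambda>i. ?c i - 1) ` ?S \<subseteq> {..<model_size l}"
  proof (rule image_subsetI)
    fix i assume "i \<in> ?S"
    then have i: "i < k2" "l $ i = 1" by auto
    have "?c i \<le> model_size l"
      unfolding model_size_def ld(1) using i by (intro sum_mono2) auto
    then show "?c i - 1 \<in> {..<model_size l}" using pos[of i] i by auto
  qed
  have "(\<lambda>i. ?c i - 1) ` ?S = {..<model_size l}"
    by (rule card_subset_eq) (use ran size inj in \<open>auto simp: card_image\<close>)
  with inj show ?thesis by (simp add: bij_betw_def)
qed

lemma selection_mat_index:
  assumes l: "l \<in> models k2" and "i < k2" "j < model_size l"
  shows "selection_mat l $$ (i, j) = of_bool (l $ i = 1 \<and> (\<Sum>r\<le>i. l $ r) - 1 = j)"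
proof -
  have "1 \<le> (\<Sum>r\<le>i. l $ r)" if "l $ i = 1"
    using that member_le_sum[of i "{..i}" "\<lambda>r. l $ r"] by auto
  then show ?thesis using assms modelsD(1)[OF l] by (auto simp: selection_mat_def)
qed

text \<open>The products of the selection matrix with its transpose depend only on the existence of some
  numbering of the included variables, so the partial sums need not be seen again.\<close>

lemma selection_mat_of_bij:
  assumes l: "l \<in> models k2"
  obtains f where "bij_betw f {i \<in> {..<k2}. l $ i = 1} {..<model_size l}"
    and "\<And>i j. i < k2 \<Longrightarrow> j < model_size l
      \<Longrightarrow> selection_mat l $$ (i, j) = of_bool (l $ i = 1 \<and> f i = j)"
  using bij_betw_selected_column[OF l] selection_mat_index[OF l] by (rule that)

lemma selection_mat_orthonormal:
  assumes l: "l \<in> models k2"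
  shows "transpose_mat (selection_mat l) * selection_mat l = 1\<^sub>m (model_size l)"
proof (rule eq_matI)
  let ?S = "{i \<in> {..<k2}. l $ i = 1}"
  obtain f where bij: "bij_betw f ?S {..<model_size l}"
    and index: "\<And>i j. i < k2 \<Longrightarrow> j < model_size l
      \<Longrightarrow> selection_mat l $$ (i, j) = of_bool (l $ i = 1 \<and> f i = j)"
    by (rule selection_mat_of_bij[OF l]) blast
  have H: "selection_mat l \<in> carrier_mat k2 (model_size l)"
    using selection_mat_carrier[of l] modelsD(1)[OF l] by simp
  fix j j' assume "j < dim_row (1\<^sub>m (model_size l) :: real mat)" "j' < dim_col (1\<^sub>m (model_size l) :: real mat)"
  then have j: "j < model_size l" "j' < model_size l" by auto
  have "j \<in> f ` ?S" unfolding bij_betw_imp_surj_on[OF bij] using j by simp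
  then obtain i where i: "i \<in> ?S" "f i = j" by blast
  have uniq: "x = i" if "x \<in> ?S" "f x = j" for x
    by (rule inj_onD[OF bij_betw_imp_inj_on[OF bij] trans[OF that(2) i(2)[symmetric]] that(1) i(1)])
  have "(transpose_mat (selection_mat l) * selection_mat l) $$ (j, j')
      = (\<Sum>x\<in>{0..<k2}. selection_mat l $$ (x, j) * selection_mat l $$ (x, j'))"
    using H j by (simp add: scalar_prod_def)
  also have "\<dots> = (\<Sum>x\<in>{0..<k2}. if x = i then of_bool (j = j') else 0)"
  proof (rule sum.cong)
    fix x assume "x \<in> {0..<k2}"
    then have x: "x < k2" by simp
    have "l $ x = 1 \<and> f x = j \<longleftrightarrow> x = i" using uniq[of x] i x by blast
    then show "selection_mat l $$ (x, j) * selection_mat l $$ (x, j')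
        = (if x = i then of_bool (j = j') else 0)"
      unfolding index[OF x j(1)] index[OF x j(2)] using i by simp
  qed simp
  also have "\<dots> = 1\<^sub>m (model_size l) $$ (j, j')" using i j by simp
  finally show "(transpose_mat (selection_mat l) * selection_mat l) $$ (j, j') = 1\<^sub>m (model_size l) $$ (j, j')" .
qed (simp_all add: selection_mat_def)

lemma selection_mat_mult_transpose:
  assumes l: "l \<in> models k2"
  shows "selection_mat l * transpose_mat (selection_mat l) = mat_diag k2 (\<lambda>i. real (l $ i))"
proof (rule eq_matI)
  let ?S = "{i \<in> {..<k2}. l $ i = 1}"
  obtain f where bij: "bij_betw f ?S {..<model_size l}"
    and index: "\<And>i j. i < k2 \<Longrightarrow> j < model_size l
      \<Longrightarrow> selection_mat l $$ (i, j) = of_bool (l $ i = 1 \<and> f i = j)"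
    by (rule selection_mat_of_bij[OF l]) blast
  have H: "selection_mat l \<in> carrier_mat k2 (model_size l)"
    using selection_mat_carrier[of l] modelsD(1)[OF l] by simp
  fix i i' assume "i < dim_row (mat_diag k2 (\<lambda>i. real (l $ i)))" "i' < dim_col (mat_diag k2 (\<lambda>i. real (l $ i)))"
  then have i: "i < k2" "i' < k2" by (auto simp: mat_diag_def)
  have f: "f x < model_size l" if "x \<in> ?S" for x
    using bij_betw_apply[OF bij that] by simp
  have uniq: "i = i'" if "i \<in> ?S" "i' \<in> ?S" "f i = f i'"
    by (rule inj_onD[OF bij_betw_imp_inj_on[OF bij] that(3) that(1,2)])
  have "(selection_mat l * transpose_mat (selection_mat l)) $$ (i, i')
      = (\<Sum>j\<in>{0..<model_size l}. selection_mat l $$ (i, j) * selection_mat l $$ (i', j))"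
    using H i by (simp add: scalar_prod_def)
  also have "\<dots> = (\<Sum>j\<in>{0..<model_size l}. if j = f i then of_bool (i = i' \<and> l $ i = 1) else 0)"
  proof (rule sum.cong)
    fix j assume "j \<in> {0..<model_size l}"
    then have j: "j < model_size l" by simp
    have "l $ i' = 1 \<and> f i' = j \<longleftrightarrow> i = i'" if "l $ i = 1" "f i = j"
      using uniq that i by blast
    then show "selection_mat l $$ (i, j) * selection_mat l $$ (i', j)
        = (if j = f i then of_bool (i = i' \<and> l $ i = 1) else 0)"
      unfolding index[OF i(1) j] index[OF i(2) j] by (cases "l $ i = 1 \<and> f i = j") auto
  qed simp
  also have "\<dots> = of_bool (i = i' \<and> l $ i = 1)" using f[of i] i by auto
  also have "\<dots> = mat_diag k2 (\<lambda>i. real (l $ i)) $$ (i, i')"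
    using i modelsD(3)[OF l, of i] by (auto simp: mat_diag_def)
  finally show "(selection_mat l * transpose_mat (selection_mat l)) $$ (i, i')
      = mat_diag k2 (\<lambda>i. real (l $ i)) $$ (i, i')" .
qed (use modelsD(1)[OF l] in \<open>simp_all add: selection_mat_def mat_diag_def\<close>)

text \<open>For square matrices over a field a one-sided inverse is two-sided, and inverses are unique.\<close>

lemma inv_mat_eqI:
  assumes A: "A \<in> carrier_mat n n" and B: "B \<in> carrier_mat n n" and AB: "A * B = 1\<^sub>m n"
  shows "inv_mat A = B"
proof -
  have BA: "B * A = 1\<^sub>m n" by (rule mat_mult_left_right_inverse[OF A B AB])
  have "mat_inverse A \<noteq> None"
  proof
    assume "mat_inverse A = None"
    from mat_inverse(1)[OF A this, of "()"] show False
      using A B AB BA by (auto simp: Units_def ring_mat_def)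
  qed
  then obtain C where C: "mat_inverse A = Some C" by auto
  from mat_inverse(2)[OF A C] have *: "C * A = 1\<^sub>m n" "C \<in> carrier_mat n n" by auto
  have "C = C * (A * B)" using AB * by simp
  also have "\<dots> = (C * A) * B" using * A B by (intro assoc_mult_mat[symmetric])
  also have "\<dots> = B" using * B by simp
  finally show ?thesis using C by (simp add: inv_mat_def)
qed

lemma inv_mat_injective:
  assumes A: "A \<in> carrier_mat n n"
    and inj: "\<And>v. v \<in> carrier_vec n \<Longrightarrow> A *\<^sub>v v = 0\<^sub>v n \<Longrightarrow> v = 0\<^sub>v n"
  shows "inv_mat A \<in> carrier_mat n n" "A * inv_mat A = 1\<^sub>m n"
proof -
  have "det A \<noteq> 0" using det_0_iff_vec_prod_zero_field[OF A] inj by auto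
  from det_non_zero_imp_unit[OF A this, of "()"]
  obtain B where B: "B \<in> carrier_mat n n" "A * B = 1\<^sub>m n"
    by (auto simp: Units_def ring_mat_def)
  then show "inv_mat A \<in> carrier_mat n n" "A * inv_mat A = 1\<^sub>m n"
    using inv_mat_eqI[OF A] by auto
qed

lemma mat_diag_mult_vec:
  assumes "v \<in> carrier_vec n" "i < n"
  shows "(mat_diag n f *\<^sub>v v) $ i = f i * (v $ i :: real)"
proof -
  have "(mat_diag n f *\<^sub>v v) $ i = (\<Sum>j\<in>{0..<n}. (if i = j then f j else 0) * v $ j)"
    using assms by (simp add: mat_diag_def scalar_prod_def)
  also have "\<dots> = (\<Sum>j\<in>{0..<n}. if i = j then f j * v $ j else 0)"
    by (intro sum.cong) auto
  finally have "(mat_diag n f *\<^sub>v v) $ i = (\<Sum>j\<in>{0..<n}. if i = j then f j * v $ j else 0)" .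
  then show ?thesis using assms by simp
qed

lemma diagonal_mat_eq_mat_diag:
  assumes "A \<in> carrier_mat n n" "diagonal_mat A"
  shows "A = mat_diag n (\<lambda>i. A $$ (i, i))"
  using assms by (intro eq_matI) (auto simp: mat_diag_def diagonal_mat_def)

text \<open>Selecting rows and columns of a diagonal matrix and inverting commute. With $E = H H'$, the diagonal
  0/1 matrix of the model, diagonal matrices commute and hence $G E G^{-1} = E$, so that
  $(H' G H)(H' G^{-1} H) = H' E H = (H' H)^2 = I$.\<close>

lemma inv_mat_selected_diagonal:
  fixes G :: "real mat"
  assumes l: "l \<in> models k2" and G: "G \<in> carrier_mat k2 k2" "diagonal_mat G"
    and pos: "\<And>i. i < k2 \<Longrightarrow> 0 < G $$ (i, i)"
  defines "H \<equiv> selection_mat l"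
  shows "inv_mat (transpose_mat H * G * H) = transpose_mat H * mat_diag k2 (\<lambda>i. 1 / G $$ (i, i)) * H"
proof -
  define m where "m = model_size l"
  define D where "D = mat_diag k2 (\<lambda>i. 1 / G $$ (i, i))"
  define E where "E = mat_diag k2 (\<lambda>i. real (l $ i))"
  have H: "H \<in> carrier_mat k2 m" and Ht: "transpose_mat H \<in> carrier_mat m k2"
    using selection_mat_carrier[of l] modelsD(1)[OF l] unfolding H_def m_def by auto
  have D: "D \<in> carrier_mat k2 k2" by (auto simp: D_def)
  have dims: "dim_row H = k2" "dim_col H = m" "dim_row G = k2" "dim_col G = k2"
    "dim_row D = k2" "dim_col D = k2"
    using H D G by auto
  have HtH: "transpose_mat H * H = 1\<^sub>m m" and HHt: "H * transpose_mat H = E"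
    using selection_mat_orthonormal[OF l] selection_mat_mult_transpose[OF l]
    by (auto simp: H_def m_def E_def)
  have "G * E * D = mat_diag k2 (\<lambda>i. G $$ (i, i) * real (l $ i) * (1 / G $$ (i, i)))"
    by (subst diagonal_mat_eq_mat_diag[OF G]) (simp only: E_def D_def mat_diag_diag)
  also have "\<dots> = E"
    unfolding E_def mat_diag_def by (rule eq_matI) (auto dest: pos)
  finally have GED: "G * E * D = E" .
  have "(transpose_mat H * G * H) * (transpose_mat H * D * H) = transpose_mat H * (G * (H * transpose_mat H) * D) * H"
    by (simp add: mult_mat_assoc dims)
  also have "\<dots> = (transpose_mat H * H) * (transpose_mat H * H)"
    unfolding HHt GED unfolding HHt[symmetric] by (simp add: mult_mat_assoc dims)
  also have "\<dots> = 1\<^sub>m m" by (simp add: HtH)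
  finally show ?thesis
    unfolding D_def[symmetric] using H Ht D G by (intro inv_mat_eqI) auto
qed

text \<open>With a diagonal Gram matrix the coefficient of an included variable does not depend on which other
  variables are included: the model enters only through the factor \<open>l $ i\<close>.\<close>

lemma selected_diagonal_solution:
  fixes G :: "real mat"
  assumes l: "l \<in> models k2" and G: "G \<in> carrier_mat k2 k2" "diagonal_mat G"
    and pos: "\<And>i. i < k2 \<Longrightarrow> 0 < G $$ (i, i)"
    and v: "v \<in> carrier_vec k2" and i: "i < k2"
  defines "H \<equiv> selection_mat l"
  shows "(H *\<^sub>v (inv_mat (transpose_mat H * G * H) *\<^sub>v (transpose_mat H *\<^sub>v v))) $ i
    = real (l $ i) * v $ i / G $$ (i, i)"
proof -
  let ?D = "mat_diag k2 (\<lambda>i. 1 / G $$ (i, i))"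
  have inv: "inv_mat (transpose_mat H * G * H) = transpose_mat H * ?D * H"
    unfolding H_def by (rule inv_mat_selected_diagonal[OF l G]) (rule pos)
  have dims: "dim_row H = k2" "dim_row ?D = k2" "dim_col ?D = k2"
    using selection_mat_carrier[of l] modelsD(1)[OF l] by (auto simp: H_def mat_diag_def)
  have "H *\<^sub>v ((transpose_mat H * ?D * H) *\<^sub>v (transpose_mat H *\<^sub>v v)) = (H * transpose_mat H) *\<^sub>v (?D *\<^sub>v ((H * transpose_mat H) *\<^sub>v v))"
    using v by (simp add: mult_mat_vec_assoc mult_mat_assoc dims)
  also have "\<dots> $ i = real (l $ i) * (1 / G $$ (i, i) * (real (l $ i) * v $ i))"
    unfolding H_def selection_mat_mult_transpose[OF l]
    by (simp only: mat_diag_mult_vec[OF v i] mat_diag_mult_vec[OF mult_mat_vec_carrier[OF mat_diag_dim] i]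
        mult_mat_vec_carrier[OF mat_diag_dim v] v)
  also have "\<dots> = real (l $ i) * v $ i / G $$ (i, i)" using modelsD(3)[OF l i] by auto
  finally show ?thesis unfolding inv .
qed

section \<open>Least squares\<close>

locale injective_design =
  fixes X1 :: "real mat" and n k1 :: nat
  assumes X1: "X1 \<in> carrier_mat n k1"
    and inj: "\<And>v. v \<in> carrier_vec k1 \<Longrightarrow> X1 *\<^sub>v v = 0\<^sub>v n \<Longrightarrow> v = 0\<^sub>v k1"
begin

definition least_squares :: "real mat" where
  "least_squares = inv_mat (transpose_mat X1 * X1) * transpose_mat X1"

lemma gram_inverse:
  "inv_mat (transpose_mat X1 * X1) \<in> carrier_mat k1 k1"
  "(transpose_mat X1 * X1) * inv_mat (transpose_mat X1 * X1) = 1\<^sub>m k1"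
proof -
  have injective: "v = 0\<^sub>v k1" if v: "v \<in> carrier_vec k1" "(transpose_mat X1 * X1) *\<^sub>v v = 0\<^sub>v k1" for v
  proof -
    have Xv: "X1 *\<^sub>v v \<in> carrier_vec n" using X1 v by auto
    have "(X1 *\<^sub>v v) \<bullet> (X1 *\<^sub>v v) = (transpose_mat X1 *\<^sub>v (X1 *\<^sub>v v)) \<bullet> v"
      using transpose_vec_mult_scalar[OF X1 v(1) Xv] by simp
    also have "transpose_mat X1 *\<^sub>v (X1 *\<^sub>v v) = 0\<^sub>v k1"
      using v X1 by (simp add: mult_mat_vec_assoc[symmetric])
    finally have "(X1 *\<^sub>v v) \<bullet> (X1 *\<^sub>v v) = 0" using v by simp
    then have "X1 *\<^sub>v v = 0\<^sub>v n"
      using Xv X1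
      by (intro eq_vecI) (auto simp: scalar_prod_def sum_nonneg_eq_0_iff simp del: index_mult_mat_vec)
    then show ?thesis by (rule inj[OF v(1)])
  qed
  have gram: "transpose_mat X1 * X1 \<in> carrier_mat k1 k1" using X1 by auto
  show "inv_mat (transpose_mat X1 * X1) \<in> carrier_mat k1 k1"
    "(transpose_mat X1 * X1) * inv_mat (transpose_mat X1 * X1) = 1\<^sub>m k1"
    by (rule inv_mat_injective[OF gram injective]; assumption)+
qed

lemma least_squares_carrier: "least_squares \<in> carrier_mat k1 n"
  using X1 gram_inverse(1) by (auto simp: least_squares_def)

lemma least_squares_vec_carrier: "r \<in> carrier_vec n \<Longrightarrow> least_squares *\<^sub>v r \<in> carrier_vec k1"
  using least_squares_carrier by auto

lemma residual_proj_carrier: "residual_proj X1 \<in> carrier_mat n n"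
  using X1 gram_inverse(1) by (auto simp: residual_proj_def)

lemma residual_proj_mult_vec:
  assumes r: "r \<in> carrier_vec n"
  shows "residual_proj X1 *\<^sub>v r = r - X1 *\<^sub>v (least_squares *\<^sub>v r)"
proof -
  have "residual_proj X1 = 1\<^sub>m n - X1 * least_squares"
    using X1 gram_inverse(1) by (simp add: residual_proj_def least_squares_def mult_mat_assoc)
  then show ?thesis
    using X1 least_squares_carrier r
    by (simp add: minus_mult_distrib_mat_vec[of _ n n] mult_mat_vec_assoc)
qed

text \<open>The normal equations.\<close>

lemma transpose_residual_eq_0:
  assumes r: "r \<in> carrier_vec n"
  shows "transpose_mat X1 *\<^sub>v (residual_proj X1 *\<^sub>v r) = 0\<^sub>v k1"
proof -
  have "transpose_mat X1 *\<^sub>v (X1 *\<^sub>v (least_squares *\<^sub>v r))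
      = ((transpose_mat X1 * X1) * inv_mat (transpose_mat X1 * X1)) *\<^sub>v (transpose_mat X1 *\<^sub>v r)"
    using X1 r gram_inverse(1)
    by (simp add: least_squares_def mult_mat_vec_assoc mult_mat_assoc)
  also have "\<dots> = transpose_mat X1 *\<^sub>v r"
    using X1 r by (simp add: gram_inverse(2))
  finally show ?thesis
    using X1 r least_squares_vec_carrier[OF r] by (simp add: residual_proj_mult_vec mult_minus_distrib_mat_vec[of _ _ n])
qed

lemma residual_orthogonal:
  assumes r: "r \<in> carrier_vec n" and v: "v \<in> carrier_vec k1"
  shows "(residual_proj X1 *\<^sub>v r) \<bullet> (X1 *\<^sub>v v) = 0"
  using transpose_vec_mult_scalar[OF X1 v, of "residual_proj X1 *\<^sub>v r"]
    transpose_residual_eq_0[OF r] residual_proj_carrier r v by simp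

text \<open>The residual is orthogonal to the fitted part of \<open>r\<close>, so one of its two factors may be replaced by
  \<open>r\<close>.\<close>

lemma residual_norm:
  assumes r: "r \<in> carrier_vec n"
  shows "(residual_proj X1 *\<^sub>v r) \<bullet> (residual_proj X1 *\<^sub>v r) = r \<bullet> (residual_proj X1 *\<^sub>v r)"
proof -
  let ?e = "residual_proj X1 *\<^sub>v r"
  have e: "?e \<in> carrier_vec n" using residual_proj_carrier r by auto
  have Xb: "X1 *\<^sub>v (least_squares *\<^sub>v r) \<in> carrier_vec n"
    using X1 least_squares_vec_carrier[OF r] by auto
  have "?e \<bullet> ?e = ?e \<bullet> (r - X1 *\<^sub>v (least_squares *\<^sub>v r))"
    by (subst (2) residual_proj_mult_vec[OF r]) (rule refl)
  also have "\<dots> = ?e \<bullet> r"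
    using scalar_prod_minus_distrib[OF e r Xb] residual_orthogonal[OF r least_squares_vec_carrier[OF r]] by simp
  also have "\<dots> = r \<bullet> ?e" by (rule comm_scalar_prod[OF e r])
  finally show ?thesis .
qed

text \<open>Reflecting a coefficient vector at the least squares solution changes the sign of the fitted
  deviation, which is orthogonal to the residual. By Pythagoras the residual sum of squares stays the
  same.\<close>

lemma residual_sum_squares_reflection:
  assumes r: "r \<in> carrier_vec n" and v: "v \<in> carrier_vec k1" and w: "w \<in> carrier_vec k1"
    and w_eq: "w = 2 \<cdot>\<^sub>v (least_squares *\<^sub>v r) - v"
  shows "(\<Sum>i<n. (r $ i - (X1 *\<^sub>v w) $ i)\<^sup>2) = (\<Sum>i<n. (r $ i - (X1 *\<^sub>v v) $ i)\<^sup>2)"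
proof -
  define c where "c = least_squares *\<^sub>v r"
  define e where "e = residual_proj X1 *\<^sub>v r"
  define u where "u = X1 *\<^sub>v (c - v)"
  have c: "c \<in> carrier_vec k1" unfolding c_def by (rule least_squares_vec_carrier[OF r])
  have e: "e \<in> carrier_vec n" "u \<in> carrier_vec n"
    using residual_proj_carrier r X1 c v by (auto simp: e_def u_def)
  have e_eq: "e = r - X1 *\<^sub>v c" unfolding e_def c_def by (rule residual_proj_mult_vec[OF r])
  have u_eq: "u = X1 *\<^sub>v c - X1 *\<^sub>v v"
    unfolding u_def by (rule mult_minus_distrib_mat_vec[OF X1 c v])
  have Xw: "X1 *\<^sub>v w = 2 \<cdot>\<^sub>v (X1 *\<^sub>v c) - X1 *\<^sub>v v"
    unfolding w_eq c_def[symmetric] using X1 c v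
    by (simp add: mult_minus_distrib_mat_vec[of _ n k1] mult_mat_vec[of _ n k1])
  have minus: "r $ i - (X1 *\<^sub>v w) $ i = e $ i - u $ i"
    and plus: "r $ i - (X1 *\<^sub>v v) $ i = e $ i + u $ i" if "i < n" for i
    unfolding e_eq u_eq Xw using that X1 r v c by (auto simp del: index_mult_mat_vec)
  have "e \<bullet> u = 0" unfolding e_def u_def using residual_orthogonal[OF r] c v by auto
  then have orth: "(\<Sum>i<n. e $ i * u $ i) = 0" using e by (simp add: scalar_prod_def lessThan_atLeast0)
  have "(\<Sum>i<n. (r $ i - (X1 *\<^sub>v w) $ i)\<^sup>2) - (\<Sum>i<n. (r $ i - (X1 *\<^sub>v v) $ i)\<^sup>2)
      = (\<Sum>i<n. (e $ i - u $ i)\<^sup>2 - (e $ i + u $ i)\<^sup>2)"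
    unfolding sum_subtractf by (intro arg_cong2[of _ _ _ _ "(-)"] sum.cong) (simp_all add: minus plus del: index_mult_mat_vec)
  also have "\<dots> = (\<Sum>i<n. (- 4) * (e $ i * u $ i))"
    by (intro sum.cong) (auto simp: power2_eq_square algebra_simps)
  also have "\<dots> = 0" by (simp only: sum_distrib_left[symmetric] orth)
  finally show ?thesis by simp
qed

end

section \<open>Lebesgue measure on vectors\<close>

lemma space_lborel_vec: "space (lborel_vec d) = carrier_vec d"
proof -
  have "v \<in> vec d ` (extensional {..<d})" if "v \<in> carrier_vec d" for v :: "real vec"
    using that by (intro image_eqI[of _ _ "\<lambda>i\<in>{..<d}. v $ i"]) auto
  then show ?thesis
    by (auto simp: lborel_vec_def space_embed_measure space_PiM PiE_def)
qed

text \<open>The map \<open>vec d\<close> is not injective, but it is on the extensional functions, which make up the product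
  space.\<close>

lemma inj_on_vec_space: "inj_on (vec d) (space (Pi\<^sub>M {..<d} (\<lambda>_. lborel :: real measure)))"
proof (rule inj_onI)
  fix f g :: "nat \<Rightarrow> real"
  assume fg: "f \<in> space (Pi\<^sub>M {..<d} (\<lambda>_. lborel))" "g \<in> space (Pi\<^sub>M {..<d} (\<lambda>_. lborel))"
    and eq: "vec d f = vec d g"
  show "f = g"
    by (rule extensionalityI[of _ "{..<d}"]) (use fg in \<open>auto simp: space_PiM PiE_def\<close>, metis eq index_vec)
qed

lemma measurable_vec_of_fun:
  "vec d \<in> measurable (Pi\<^sub>M {..<d} (\<lambda>_. lborel)) (lborel_vec d)"
  unfolding lborel_vec_def by (rule measurable_embed_measure2'[OF inj_on_vec_space])

lemma measurable_lborel_vec_component: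
  assumes "i < d"
  shows "(\<lambda>v. v $ i) \<in> borel_measurable (lborel_vec d)"
  unfolding lborel_vec_def
proof (rule measurable_embed_measure1)
  show "(\<lambda>x. vec d x $ i) \<in> borel_measurable (Pi\<^sub>M {..<d} (\<lambda>_. lborel))"
    using assms measurable_component_singleton[of i "{..<d}" "\<lambda>_. lborel :: real measure"] by simp
qed

lemma measurable_into_lborel_vec:
  assumes "\<And>i. i < d \<Longrightarrow> (\<lambda>x. f x i) \<in> borel_measurable M"
  shows "(\<lambda>x. vec d (f x)) \<in> measurable M (lborel_vec d)"
proof -
  have "(\<lambda>x. \<lambda>i\<in>{..<d}. f x i) \<in> measurable M (Pi\<^sub>M {..<d} (\<lambda>_. lborel))"
    using assms by (intro measurable_restrict) auto
  from measurable_compose[OF this measurable_vec_of_fun]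
  have "(\<lambda>x. vec d (\<lambda>i\<in>{..<d}. f x i)) \<in> measurable M (lborel_vec d)" .
  moreover have "vec d (\<lambda>i\<in>{..<d}. f x i) = vec d (f x)" for x by (rule eq_vecI) auto
  ultimately show ?thesis by simp
qed

lemma lborel_reflection: "distr lborel lborel (\<lambda>t. c - t) = (lborel :: real measure)"
proof -
  have "distr lborel borel (\<lambda>t. c - t) = (lborel :: real measure)"
    using lborel_real_affine[of "-1" c] by (simp add: density_1 one_ennreal_def[symmetric])
  then show ?thesis by (simp cong: distr_cong)
qed

lemma lborel_PiM_reflection:
  fixes c :: "nat \<Rightarrow> real"
  shows "distr (Pi\<^sub>M {..<d} (\<lambda>_. lborel)) (Pi\<^sub>M {..<d} (\<lambda>_. lborel)) (\<lambda>x. \<lambda>i\<in>{..<d}. c i - x i)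
    = Pi\<^sub>M {..<d} (\<lambda>_. lborel)"
    (is "distr ?M ?M ?r = ?M")
proof -
  interpret product_sigma_finite "\<lambda>_. lborel :: real measure" by standard
  have r: "?r \<in> measurable ?M ?M" by (intro measurable_restrict) auto
  show ?thesis
  proof (rule PiM_eqI)
    fix A assume A: "\<And>i. i \<in> {..<d} \<Longrightarrow> A i \<in> sets (lborel :: real measure)"
    have pre: "(\<lambda>t. c i - t) -` A i \<in> sets lborel" if "i \<in> {..<d}" for i
      using measurable_sets[of "\<lambda>t. c i - t" lborel lborel "A i"] A[OF that] by simp
    have "emeasure (distr ?M ?M ?r) (Pi\<^sub>E {..<d} A) = emeasure ?M (?r -` (Pi\<^sub>E {..<d} A) \<inter> space ?M)"
      using A r by (intro emeasure_distr) auto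
    also have "?r -` (Pi\<^sub>E {..<d} A) \<inter> space ?M = Pi\<^sub>E {..<d} (\<lambda>i. (\<lambda>t. c i - t) -` A i)"
      by (auto simp: space_PiM PiE_def Pi_def extensional_def)
    also have "emeasure ?M \<dots> = (\<Prod>i<d. emeasure lborel ((\<lambda>t. c i - t) -` A i))"
      using pre by (intro emeasure_PiM) auto
    also have "\<dots> = (\<Prod>i<d. emeasure lborel (A i))"
    proof (rule prod.cong)
      fix i assume i: "i \<in> {..<d}"
      have "emeasure lborel (A i) = emeasure (distr lborel lborel (\<lambda>t. c i - t)) (A i)"
        by (simp only: lborel_reflection)
      also have "\<dots> = emeasure lborel ((\<lambda>t. c i - t) -` A i)"
        using A[OF i] by (subst emeasure_distr) auto
      finally show "emeasure lborel ((\<lambda>t. c i - t) -` A i) = emeasure lborel (A i)" by simp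
    qed simp
    finally show "emeasure (distr ?M ?M ?r) (Pi\<^sub>E {..<d} A) = (\<Prod>i<d. emeasure lborel (A i))" .
  qed auto
qed

lemma nn_integral_lborel_vec_reflection:
  assumes F: "F \<in> borel_measurable (lborel_vec d)"
  shows "(\<integral>\<^sup>+v. F (vec d (\<lambda>i. c i - v $ i)) \<partial>lborel_vec d) = (\<integral>\<^sup>+v. F v \<partial>lborel_vec d)"
proof -
  let ?M = "Pi\<^sub>M {..<d} (\<lambda>_. lborel :: real measure)"
  let ?r = "\<lambda>x. \<lambda>i\<in>{..<d}. c i - x i"
  have r: "?r \<in> measurable ?M ?M" by (intro measurable_restrict) auto
  have refl: "(\<lambda>v. vec d (\<lambda>i. c i - v $ i)) \<in> measurable (lborel_vec d) (lborel_vec d)"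
    by (intro measurable_into_lborel_vec borel_measurable_diff measurable_lborel_vec_component) auto
  have Fvec: "(\<lambda>x. F (vec d x)) \<in> borel_measurable ?M"
    by (rule measurable_compose[OF measurable_vec_of_fun F])
  have "(\<integral>\<^sup>+v. F (vec d (\<lambda>i. c i - v $ i)) \<partial>lborel_vec d)
      = (\<integral>\<^sup>+x. F (vec d (\<lambda>i. c i - vec d x $ i)) \<partial>?M)"
    using measurable_compose[OF refl F] unfolding lborel_vec_def
    by (intro nn_integral_embed_measure'[OF inj_on_vec_space])
  also have "\<dots> = (\<integral>\<^sup>+x. F (vec d (?r x)) \<partial>?M)"
    by (intro nn_integral_cong arg_cong[of _ _ F] eq_vecI) auto
  also have "\<dots> = (\<integral>\<^sup>+x. F (vec d x) \<partial>distr ?M ?M ?r)"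
    by (subst nn_integral_distr[OF r]) (simp_all only: Fvec measurable_distr_eq1)
  also have "\<dots> = (\<integral>\<^sup>+x. F (vec d x) \<partial>?M)" by (simp only: lborel_PiM_reflection)
  also have "\<dots> = (\<integral>\<^sup>+v. F v \<partial>lborel_vec d)"
    using F unfolding lborel_vec_def
    by (intro nn_integral_embed_measure'[OF inj_on_vec_space, symmetric])
  finally show ?thesis .
qed

text \<open>Reading off the coordinates maps the measure back to the product of Lebesgue measures, and
  sigma-finiteness of an image measure passes to the original one.\<close>

lemma sigma_finite_lborel_vec: "sigma_finite_measure (lborel_vec d)"
proof -
  let ?M = "Pi\<^sub>M {..<d} (\<lambda>_. lborel :: real measure)"
  let ?g = "\<lambda>v :: real vec. \<lambda>i\<in>{..<d}. v $ i"
  interpret product_sigma_finite "\<lambda>_. lborel :: real measure" by standard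
  have g: "?g \<in> measurable (lborel_vec d) ?M"
    using measurable_lborel_vec_component by (intro measurable_restrict) auto
  have "distr (lborel_vec d) ?M ?g = distr (distr ?M (lborel_vec d) (vec d)) ?M ?g"
    using embed_measure_eq_distr'[OF inj_on_vec_space, of d] by (simp add: lborel_vec_def)
  also have "\<dots> = distr ?M ?M (?g \<circ> vec d)" by (rule distr_distr[OF g measurable_vec_of_fun])
  also have "\<dots> = distr ?M ?M (\<lambda>x. x)"
    by (intro distr_cong) (auto simp: space_PiM PiE_def extensional_def)
  also have "\<dots> = ?M" by (rule distr_id2) simp
  finally have "distr (lborel_vec d) ?M ?g = ?M" .
  then have "sigma_finite_measure (distr (lborel_vec d) ?M ?g)"
    using sigma_finite[of "{..<d}"] by simp
  then show ?thesis by (rule sigma_finite_measure_distr[OF _ g])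
qed

text \<open>By Fubini, a reflection of the first component whose centre depends on the second component
  preserves the product measure, because it does so on each fibre.\<close>

lemma distr_fibrewise_reflection:
  assumes N: "sigma_finite_measure N"
    and c: "\<And>i. i < d \<Longrightarrow> (\<lambda>z. c z i) \<in> borel_measurable N"
  defines "T \<equiv> \<lambda>(v, z). (vec d (\<lambda>i. c z i - v $ i), z)"
  shows "T \<in> measurable (lborel_vec d \<Otimes>\<^sub>M N) (lborel_vec d \<Otimes>\<^sub>M N)"
    and "distr (lborel_vec d \<Otimes>\<^sub>M N) (lborel_vec d \<Otimes>\<^sub>M N) T = lborel_vec d \<Otimes>\<^sub>M N"
proof -
  let ?M = "lborel_vec d \<Otimes>\<^sub>M N"
  interpret L: sigma_finite_measure "lborel_vec d" by (rule sigma_finite_lborel_vec)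
  interpret N: sigma_finite_measure N by (rule N)
  interpret pair_sigma_finite "lborel_vec d" N ..
  have "(\<lambda>x. vec d (\<lambda>i. c (snd x) i - fst x $ i)) \<in> measurable ?M (lborel_vec d)"
    by (intro measurable_into_lborel_vec borel_measurable_diff
        measurable_compose[OF measurable_snd c] measurable_compose[OF measurable_fst measurable_lborel_vec_component])
  then show T: "T \<in> measurable ?M ?M"
    unfolding T_def case_prod_beta by (intro measurable_Pair) auto
  show "distr ?M ?M T = ?M"
  proof (rule measure_eqI)
    fix A assume "A \<in> sets (distr ?M ?M T)"
    then have A: "A \<in> sets ?M" by simp
    have ind: "indicator A \<in> borel_measurable ?M" using A by simp
    have indT: "(\<lambda>x. indicator A (T x) :: ennreal) \<in> borel_measurable ?M"
      by (rule measurable_compose[OF T ind])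
    have "emeasure (distr ?M ?M T) A = (\<integral>\<^sup>+x. indicator A x \<partial>distr ?M ?M T)" using A by simp
    also have "\<dots> = (\<integral>\<^sup>+x. indicator A (T x) \<partial>?M)" using T ind by (intro nn_integral_distr) auto
    also have "\<dots> = (\<integral>\<^sup>+z. (\<integral>\<^sup>+v. indicator A (T (v, z)) \<partial>lborel_vec d) \<partial>N)"
      by (rule nn_integral_snd[OF indT, symmetric])
    also have "\<dots> = (\<integral>\<^sup>+z. (\<integral>\<^sup>+v. indicator A (v, z) \<partial>lborel_vec d) \<partial>N)"
    proof (rule nn_integral_cong)
      fix z assume z: "z \<in> space N"
      have "(\<lambda>v. indicator A (v, z) :: ennreal) \<in> borel_measurable (lborel_vec d)"
        by (rule measurable_compose[OF measurable_Pair2'[OF z] ind])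
      from nn_integral_lborel_vec_reflection[OF this, of "c z"]
      show "(\<integral>\<^sup>+v. indicator A (T (v, z)) \<partial>lborel_vec d) = (\<integral>\<^sup>+v. indicator A (v, z) \<partial>lborel_vec d)"
        by (simp add: T_def)
    qed
    also have "\<dots> = (\<integral>\<^sup>+x. indicator A x \<partial>?M)" by (rule nn_integral_snd[OF ind])
    also have "\<dots> = emeasure ?M A" using A by simp
    finally show "emeasure (distr ?M ?M T) A = emeasure ?M A" .
  qed simp
qed

lemma distr_density_invariant:
  assumes T: "T \<in> measurable M M" and inv: "distr M M T = M"
    and h: "h \<in> borel_measurable M" and hT: "AE x in M. h (T x) = h x"
  shows "distr (density M h) (density M h) T = density M h"
proof -
  have "density M h = density (distr M M T) h" by (simp only: inv)
  also have "\<dots> = distr (density M (\<lambda>x. h (T x))) M T" by (rule density_distr[OF h T])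
  also have "density M (\<lambda>x. h (T x)) = density M h"
    by (rule density_cong[OF measurable_compose[OF T h] h hT])
  finally have "density M h = distr (density M h) M T" .
  moreover have "distr (density M h) (density M h) T = distr (density M h) M T"
    by (rule distr_cong) auto
  ultimately show ?thesis by (rule trans[OF _ sym, rotated])
qed

section \<open>Posterior mean of the common coefficients\<close>

lemma sigma_finite_param_tail:
  assumes "sd_prior S"
  shows "sigma_finite_measure (lborel_vec m \<Otimes>\<^sub>M S)"
  using assms by (intro sigma_finite_pair_measure sigma_finite_lborel_vec) (auto simp: sd_prior_def)

lemma AE_param_measure_sd_pos:
  assumes S: "sd_prior S"
  shows "AE (b1, bl, s) in param_measure X1 Xl S. 0 < s"
proof -
  let ?A = "lborel_vec (dim_col X1)" and ?B = "lborel_vec (dim_col Xl)"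
  have sets: "sets S = sets borel" and fin: "sigma_finite_measure S" and null: "emeasure S {..0} = 0"
    using S by (auto simp: sd_prior_def)
  interpret S: sigma_finite_measure S by (rule fin)
  interpret BS: sigma_finite_measure "?B \<Otimes>\<^sub>M S" by (rule sigma_finite_param_tail[OF S])
  have "emeasure (?A \<Otimes>\<^sub>M (?B \<Otimes>\<^sub>M S)) (space ?A \<times> (space ?B \<times> {..0}))
      = emeasure ?A (space ?A) * (emeasure ?B (space ?B) * emeasure S {..0})"
    using sets by (subst BS.emeasure_pair_measure_Times; (subst S.emeasure_pair_measure_Times)?) auto
  then have "emeasure (?A \<Otimes>\<^sub>M (?B \<Otimes>\<^sub>M S)) (space ?A \<times> (space ?B \<times> {..0})) = 0"
    using null by simp
  moreover have "space ?A \<times> (space ?B \<times> {..0}) \<in> sets (?A \<Otimes>\<^sub>M (?B \<Otimes>\<^sub>M S))"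
    using sets by (intro pair_measureI) auto
  ultimately have "space ?A \<times> (space ?B \<times> {..0}) \<in> null_sets (?A \<Otimes>\<^sub>M (?B \<Otimes>\<^sub>M S))" by auto
  then show ?thesis
    unfolding param_measure_def by (rule AE_I') (auto simp: space_pair_measure not_less)
qed

lemma param_measure_common_component:
  "i < dim_col X1 \<Longrightarrow> (\<lambda>x. fst x $ i) \<in> borel_measurable (param_measure X1 Xl S)"
  unfolding param_measure_def by (rule measurable_compose[OF measurable_fst measurable_lborel_vec_component])

lemma param_measure_noncommon_component:
  "j < dim_col Xl \<Longrightarrow> (\<lambda>x. fst (snd x) $ j) \<in> borel_measurable (param_measure X1 Xl S)"
  unfolding param_measure_def
  by (rule measurable_compose[OF measurable_compose[OF measurable_snd measurable_fst] measurable_lborel_vec_component])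

lemma param_measure_sd:
  assumes "sets S = sets borel"
  shows "(\<lambda>x. snd (snd x)) \<in> borel_measurable (param_measure X1 Xl S)"
proof -
  have "(\<lambda>x. snd (snd x)) \<in> measurable (param_measure X1 Xl S) S"
    unfolding param_measure_def by (rule measurable_compose[OF measurable_snd measurable_snd])
  then show ?thesis using measurable_cong_sets[OF refl assms] by blast
qed

lemma likelihood_measurable:
  assumes X: "X1 \<in> carrier_mat n k1" "Xl \<in> carrier_mat n m" and y: "y \<in> carrier_vec n"
    and S: "sd_prior S"
  shows "(\<lambda>(b1, bl, s). likelihood X1 Xl y b1 bl s) \<in> borel_measurable (param_measure X1 Xl S)"
proof -
  let ?M = "param_measure X1 Xl S"
  have sets: "sets S = sets borel" using S by (simp add: sd_prior_def)
  let ?\<mu> = "\<lambda>i x. (\<Sum>j<k1. X1 $$ (i, j) * fst x $ j) + (\<Sum>j<m. Xl $$ (i, j) * fst (snd x) $ j)"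
  have mean[measurable]: "?\<mu> i \<in> borel_measurable ?M" for i
    using X by (intro borel_measurable_add borel_measurable_sum borel_measurable_times borel_measurable_const
        param_measure_common_component param_measure_noncommon_component) auto
  note param_measure_sd[OF sets, measurable]
  have "(\<lambda>x. \<Prod>i<n. normal_density (?\<mu> i x) (snd (snd x)) (y $ i)) \<in> borel_measurable ?M"
    unfolding normal_density_def by measurable
  also have "?this \<longleftrightarrow> ?thesis"
  proof (rule measurable_cong)
    fix x assume "x \<in> space ?M"
    then have c: "fst x \<in> carrier_vec k1" "fst (snd x) \<in> carrier_vec m"
      using X by (auto simp: param_measure_def space_pair_measure space_lborel_vec)
    have "(X1 *\<^sub>v fst x + Xl *\<^sub>v fst (snd x)) $ i = ?\<mu> i x" if "i < n" for i
      using that X c by (simp add: scalar_prod_def lessThan_atLeast0)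
    then show "(\<Prod>i<n. normal_density (?\<mu> i x) (snd (snd x)) (y $ i))
        = (case x of (b1, bl, s) \<Rightarrow> likelihood X1 Xl y b1 bl s)"
      using y by (simp add: likelihood_def case_prod_beta')
  qed
  finally show ?thesis .
qed

text \<open>The common coefficients enter the likelihood only through the residual sum of squares.\<close>

lemma likelihood_eq_residual:
  assumes "0 < s" and "dim_vec y = n"
  shows "likelihood X1 Xl y b1 bl s
    = (1 / sqrt (2 * pi * s\<^sup>2)) ^ n * exp (- (\<Sum>i<n. (y $ i - (X1 *\<^sub>v b1 + Xl *\<^sub>v bl) $ i)\<^sup>2) / (2 * s\<^sup>2))"
proof -
  have "likelihood X1 Xl y b1 bl s = (\<Prod>i<n. (1 / sqrt (2 * pi * s\<^sup>2)) *
      exp (- (y $ i - (X1 *\<^sub>v b1 + Xl *\<^sub>v bl) $ i)\<^sup>2 / (2 * s\<^sup>2)))"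
    unfolding likelihood_def normal_density_def assms(2) by simp
  also have "\<dots> = (1 / sqrt (2 * pi * s\<^sup>2)) ^ n *
      exp (\<Sum>i<n. - (y $ i - (X1 *\<^sub>v b1 + Xl *\<^sub>v bl) $ i)\<^sup>2 / (2 * s\<^sup>2))"
    by (simp only: prod.distrib prod_constant card_lessThan exp_sum[OF finite_lessThan, symmetric])
  finally show ?thesis by (simp only: sum_divide_distrib[symmetric] sum_negf)
qed

context injective_design
begin

lemma likelihood_reflection:
  assumes Xl: "Xl \<in> carrier_mat n m" and y: "y \<in> carrier_vec n" and s: "0 < s"
    and b1: "b1 \<in> carrier_vec k1" and bl: "bl \<in> carrier_vec m"
  shows "likelihood X1 Xl y (vec k1 (\<lambda>i. 2 * (least_squares *\<^sub>v (y - Xl *\<^sub>v bl)) $ i - b1 $ i)) bl s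
    = likelihood X1 Xl y b1 bl s"
proof -
  define r where "r = y - Xl *\<^sub>v bl"
  define w where "w = vec k1 (\<lambda>i. 2 * (least_squares *\<^sub>v r) $ i - b1 $ i)"
  have r: "r \<in> carrier_vec n" using y Xl bl by (auto simp: r_def)
  have w: "w \<in> carrier_vec k1" by (simp add: w_def)
  have w_eq: "w = 2 \<cdot>\<^sub>v (least_squares *\<^sub>v r) - b1"
    using b1 carrier_matD(1)[OF least_squares_carrier] by (intro eq_vecI) (auto simp: w_def simp del: index_mult_mat_vec)
  have res: "y $ i - (X1 *\<^sub>v v + Xl *\<^sub>v bl) $ i = r $ i - (X1 *\<^sub>v v) $ i" if "i < n" for i v
    using that X1 y Xl by (simp add: r_def del: index_mult_mat_vec)
  have dy: "dim_vec y = n" using y by simp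
  show ?thesis
    unfolding r_def[symmetric] w_def[symmetric] likelihood_eq_residual[OF s dy]
    using residual_sum_squares_reflection[OF r b1 w w_eq] by (simp add: res del: index_mult_mat_vec)
qed

text \<open>For fixed noncommon coefficients \<open>bl\<close> and standard deviation, the posterior density of the common
  coefficients is symmetric about the least squares solution for the response \<open>y - Xl *\<^sub>v bl\<close>, since the
  likelihood is and the prior is flat. The reflection \<open>T\<close> of the parameter space at these centres
  preserves the posterior, so each common coefficient has the same mean as its reflection, which is
  twice the centre minus the coefficient. The centre is affine in \<open>bl\<close>, so that its mean is its value
  at the mean of \<open>bl\<close>. No Gaussian integral has to be evaluated.\<close>

lemma mean_common_eq_least_squares:
  assumes Xl: "Xl \<in> carrier_mat n m" and y: "y \<in> carrier_vec n"
    and S: "sd_prior S" and prior: "prior_density X1 Xl \<pi> S"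
    and proper: "proper_posterior X1 Xl y \<pi> S"
    and means: "has_coefficient_means k1 m (posterior X1 Xl y \<pi> S)"
    and flat: "\<And>b1 bl s. b1 \<in> carrier_vec k1 \<Longrightarrow> bl \<in> carrier_vec m \<Longrightarrow> 0 < s \<Longrightarrow> \<pi> b1 bl s = g bl s"
  shows "mean_common k1 (posterior X1 Xl y \<pi> S)
    = least_squares *\<^sub>v (y - Xl *\<^sub>v mean_noncommon m (posterior X1 Xl y \<pi> S))"
proof -
  define N where "N = lborel_vec m \<Otimes>\<^sub>M S"
  define M where "M = param_measure X1 Xl S"
  define h where "h = (\<lambda>(b1, bl, s). ennreal (likelihood X1 Xl y b1 bl s * \<pi> b1 bl s) / marginal_likelihood X1 Xl y \<pi> S)"
  define post where "post = posterior X1 Xl y \<pi> S"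
  define c0 where "c0 i = (least_squares *\<^sub>v y) $ i" for i
  define C where "C = least_squares * Xl"
  define c where "c bl i = (least_squares *\<^sub>v (y - Xl *\<^sub>v bl)) $ i" for bl i
  define T where "T = (\<lambda>(b1, z). (vec k1 (\<lambda>i. 2 * c (fst z) i - b1 $ i), z :: real vec \<times> real))"
  have C: "C \<in> carrier_mat k1 m" using least_squares_carrier Xl by (auto simp: C_def)
  have c_eq: "c bl i = c0 i - (\<Sum>j<m. C $$ (i, j) * bl $ j)" if bl: "bl \<in> carrier_vec m" and i: "i < k1" for bl i
  proof -
    have "least_squares *\<^sub>v (y - Xl *\<^sub>v bl) = least_squares *\<^sub>v y - C *\<^sub>v bl"
      using least_squares_carrier Xl y bl
      by (simp add: C_def mult_minus_distrib_mat_vec[of _ k1 n] mult_mat_vec_assoc)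
    then have "c bl i = c0 i - (C *\<^sub>v bl) $ i"
      using i C least_squares_carrier by (simp add: c_def c0_def del: index_mult_mat_vec)
    then show ?thesis using i C bl by (simp add: scalar_prod_def lessThan_atLeast0)
  qed
  have M_eq: "M = lborel_vec k1 \<Otimes>\<^sub>M N" using X1 Xl by (simp add: M_def N_def param_measure_def)
  have post_eq: "post = density M h" by (simp add: post_def posterior_def M_def h_def)
  have spaceM: "x \<in> space M \<Longrightarrow> fst x \<in> carrier_vec k1 \<and> fst (snd x) \<in> carrier_vec m" for x
    by (auto simp: M_eq N_def space_pair_measure space_lborel_vec)
  have N: "sigma_finite_measure N" unfolding N_def by (rule sigma_finite_param_tail[OF S])
  have c_meas: "(\<lambda>z. 2 * c (fst z) i) \<in> borel_measurable N" if i: "i < k1" for i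
  proof -
    have "(\<lambda>z. 2 * (c0 i - (\<Sum>j<m. C $$ (i, j) * fst z $ j))) \<in> borel_measurable N"
      unfolding N_def
      by (intro borel_measurable_times borel_measurable_diff borel_measurable_sum borel_measurable_const
          measurable_compose[OF measurable_fst measurable_lborel_vec_component]) auto
    then show ?thesis
      by (rule measurable_cong[THEN iffD1, rotated])
        (auto simp: N_def space_pair_measure space_lborel_vec c_eq[OF _ i])
  qed
  have T: "T \<in> measurable M M" and T_inv: "distr M M T = M"
    unfolding M_eq T_def by (rule distr_fibrewise_reflection[OF N c_meas]; assumption)+
  (* The quotient by the evidence inherits measurability from the unnormalized density. *)
  have numerator: "(\<lambda>(b1, bl, s). likelihood X1 Xl y b1 bl s * \<pi> b1 bl s) \<in> borel_measurable M"
    using borel_measurable_times[OF likelihood_measurable[OF X1 Xl y S]] prior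
    unfolding prior_density_def M_def case_prod_beta' by blast
  then have num': "(\<lambda>(b1, bl, s). ennreal (likelihood X1 Xl y b1 bl s * \<pi> b1 bl s)) \<in> borel_measurable M"
    unfolding case_prod_beta' by (rule measurable_compose) simp
  then have h: "h \<in> borel_measurable M"
    unfolding h_def case_prod_beta' by (intro borel_measurable_divide_ennreal) auto
  (* The symmetry needs a positive standard deviation, which the prior guarantees almost everywhere. *)
  have hT: "AE x in M. h (T x) = h x"
    using AE_param_measure_sd_pos[OF S, of X1 Xl] AE_space[of M] unfolding M_def[symmetric]
  proof eventually_elim
    case (elim x)
    obtain b1 bl s where x: "x = (b1, bl, s)" by (cases x)
    have in_space: "b1 \<in> carrier_vec k1" "bl \<in> carrier_vec m" and s: "0 < s"
      using elim spaceM[of x] x by auto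
    show ?case
      using likelihood_reflection[OF Xl y s in_space] flat[OF _ in_space(2) s] in_space
      by (simp add: x h_def T_def c_def del: index_mult_mat_vec)
  qed
  have Tpost: "T \<in> measurable post post" using T by (simp add: post_eq)
  have Tpost_inv: "distr post post T = post"
    unfolding post_eq by (rule distr_density_invariant[OF T T_inv h hT])
  (* Constants integrate to themselves only because the evidence is positive and finite. *)
  have total: "emeasure post (space post) = 1"
  proof -
    have "emeasure post (space post) = (\<integral>\<^sup>+x. h x \<partial>M)"
      unfolding post_eq using h by (simp add: emeasure_density cong: nn_integral_cong)
    also have "\<dots> = marginal_likelihood X1 Xl y \<pi> S / marginal_likelihood X1 Xl y \<pi> S"
      unfolding h_def case_prod_beta' marginal_likelihood_def
      using num'[unfolded case_prod_beta'] by (subst nn_integral_divide) (auto simp: M_def)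
    also have "\<dots> = 1"
      using proper by (intro ennreal_divide_self) (auto simp: proper_posterior_def)
    finally show ?thesis .
  qed
  interpret post: prob_space post by (rule prob_spaceI[OF total])
  have int1: "integrable post (\<lambda>x. fst x $ i)" if "i < k1" for i
    using means that unfolding has_coefficient_means_def post_def case_prod_beta' by blast
  have int2: "integrable post (\<lambda>x. fst (snd x) $ j)" if "j < m" for j
    using means that unfolding has_coefficient_means_def post_def case_prod_beta' by blast
  define e2 where "e2 = mean_noncommon m post"
  have e2: "e2 \<in> carrier_vec m" "\<And>j. j < m \<Longrightarrow> e2 $ j = (\<integral>x. fst (snd x) $ j \<partial>post)"
    by (auto simp: e2_def mean_noncommon_def case_prod_beta')
  have "(\<integral>x. fst x $ i \<partial>post) = c e2 i" if i: "i < k1" for i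
  proof -
    let ?L = "\<lambda>x. c0 i - (\<Sum>j<m. C $$ (i, j) * fst (snd x) $ j)"
    have intS: "integrable post (\<lambda>x. \<Sum>j<m. C $$ (i, j) * fst (snd x) $ j)"
      using int2 by (intro Bochner_Integration.integrable_sum integrable_mult_right) auto
    have intL: "integrable post ?L" using intS by (intro Bochner_Integration.integrable_diff) auto
    have "(\<integral>x. fst x $ i \<partial>post) = (\<integral>x. fst x $ i \<partial>distr post post T)" by (simp only: Tpost_inv)
    also have "\<dots> = (\<integral>x. fst (T x) $ i \<partial>post)"
      by (rule integral_distr[OF Tpost]) (use int1[OF i] in auto)
    also have "\<dots> = (\<integral>x. 2 * ?L x - fst x $ i \<partial>post)"
      by (rule Bochner_Integration.integral_cong)
        (use i spaceM in \<open>auto simp: post_eq T_def c_eq[OF _ i]\<close>)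
    also have "\<dots> = 2 * (\<integral>x. ?L x \<partial>post) - (\<integral>x. fst x $ i \<partial>post)"
      unfolding Bochner_Integration.integral_diff[OF integrable_mult_right[OF intL] int1[OF i]] by (simp only: integral_mult_right_zero)
    finally have "(\<integral>x. fst x $ i \<partial>post) = (\<integral>x. ?L x \<partial>post)" by simp
    also have "\<dots> = c0 i - (\<integral>x. (\<Sum>j<m. C $$ (i, j) * fst (snd x) $ j) \<partial>post)"
      using intS by (subst Bochner_Integration.integral_diff) (auto simp: post.prob_space)
    also have "(\<integral>x. (\<Sum>j<m. C $$ (i, j) * fst (snd x) $ j) \<partial>post) = (\<Sum>j<m. C $$ (i, j) * e2 $ j)"
      using int2 e2(2) by (subst Bochner_Integration.integral_sum) auto
    finally show ?thesis by (simp add: c_eq[OF e2(1) i])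
  qed
  then have "mean_common k1 post = least_squares *\<^sub>v (y - Xl *\<^sub>v e2)"
    using least_squares_carrier
    by (intro eq_vecI) (auto simp: mean_common_def case_prod_beta' c_def simp del: index_mult_mat_vec)
  then show ?thesis by (simp only: post_def e2_def)
qed

end

section \<open>Predictive risk\<close>

lemma full_design_mult_append:
  assumes X1: "X1 \<in> carrier_mat n k1" and X2: "X2 \<in> carrier_mat n k2"
    and v: "v \<in> carrier_vec k1" and w: "w \<in> carrier_vec k2"
  shows "full_design X1 X2 *\<^sub>v (v @\<^sub>v w) = X1 *\<^sub>v v + X2 *\<^sub>v w"
proof (rule eq_vecI)
  fix i assume "i < dim_vec (X1 *\<^sub>v v + X2 *\<^sub>v w)"
  then have i: "i < n" using X2 by simp
  have "row (full_design X1 X2) i = row X1 i @\<^sub>v row X2 i"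
    using X1 X2 i
    by (intro eq_vecI) (auto simp: full_design_def mat_of_cols_index nth_append cols_def)
  then show "(full_design X1 X2 *\<^sub>v (v @\<^sub>v w)) $ i = (X1 *\<^sub>v v + X2 *\<^sub>v w) $ i"
    using X1 X2 v w i scalar_prod_append[of "row X1 i" k1 "row X2 i" k2 v w]
    by (simp add: full_design_def)
qed (use X1 X2 in \<open>simp_all add: full_design_def\<close>)

lemma full_design_carrier:
  "X1 \<in> carrier_mat n k1 \<Longrightarrow> X2 \<in> carrier_mat n k2 \<Longrightarrow> full_design X1 X2 \<in> carrier_mat n (k1 + k2)"
  by (auto simp: full_design_def)

lemma scalar_prod_scaled_gram:
  fixes F :: "real mat"
  assumes F: "F \<in> carrier_mat n k" and u: "u \<in> carrier_vec k"
  shows "u \<bullet> ((\<gamma> \<cdot>\<^sub>m (transpose_mat F * F)) *\<^sub>v u) = \<gamma> * ((F *\<^sub>v u) \<bullet> (F *\<^sub>v u))"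
proof -
  have Fu: "F *\<^sub>v u \<in> carrier_vec n" using F u by auto
  have gram: "(transpose_mat F * F) *\<^sub>v u = transpose_mat F *\<^sub>v (F *\<^sub>v u)"
    using F u by (simp add: mult_mat_vec_assoc)
  have "(\<gamma> \<cdot>\<^sub>m (transpose_mat F * F)) *\<^sub>v u = \<gamma> \<cdot>\<^sub>v (transpose_mat F *\<^sub>v (F *\<^sub>v u))"
    unfolding gram[symmetric] using F u by (intro eq_vecI) auto
  then have "u \<bullet> ((\<gamma> \<cdot>\<^sub>m (transpose_mat F * F)) *\<^sub>v u) = \<gamma> * (u \<bullet> (transpose_mat F *\<^sub>v (F *\<^sub>v u)))"
    using F u Fu by simp
  also have "u \<bullet> (transpose_mat F *\<^sub>v (F *\<^sub>v u)) = (F *\<^sub>v u) \<bullet> (F *\<^sub>v u)"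
    using transpose_vec_mult_scalar[OF F u Fu] comm_scalar_prod[OF u, of "transpose_mat F *\<^sub>v (F *\<^sub>v u)"] F Fu
    by simp
  finally show ?thesis .
qed

text \<open>A kernel vector of \<open>X1\<close>, padded with zeros, is a null vector of the quadratic form,
  which definiteness excludes unless it is zero.\<close>

lemma injective_design_of_pos_def:
  assumes X1: "X1 \<in> carrier_mat n k1" and X2: "X2 \<in> carrier_mat n k2"
    and Q: "pos_def_mat (\<gamma> \<cdot>\<^sub>m (transpose_mat (full_design X1 X2) * full_design X1 X2))"
  shows "injective_design X1 n k1"
proof (unfold_locales, rule X1)
  fix v assume v: "v \<in> carrier_vec k1" and X1v: "X1 *\<^sub>v v = 0\<^sub>v n"
  let ?F = "full_design X1 X2" and ?u = "v @\<^sub>v 0\<^sub>v k2"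
  have F: "?F \<in> carrier_mat n (k1 + k2)" by (rule full_design_carrier[OF X1 X2])
  have u: "?u \<in> carrier_vec (k1 + k2)" using v by simp
  have "?F *\<^sub>v ?u = 0\<^sub>v n"
    unfolding full_design_mult_append[OF X1 X2 v zero_carrier_vec] X1v using X2 by (intro eq_vecI) auto
  then have "?u \<bullet> ((\<gamma> \<cdot>\<^sub>m (transpose_mat ?F * ?F)) *\<^sub>v ?u) = 0"
    using scalar_prod_scaled_gram[OF F u] by simp
  then have u0: "?u = 0\<^sub>v (k1 + k2)"
    using Q u F unfolding pos_def_mat_def by fastforce
  show "v = 0\<^sub>v k1"
  proof (rule eq_vecI)
    fix i assume i: "i < dim_vec (0\<^sub>v k1 :: real vec)"
    have "v $ i = ?u $ i" using i v by simp
    then show "v $ i = 0\<^sub>v k1 $ i" using i by (simp add: u0)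
  qed (use v in simp)
qed

lemma second_moments_quadratic_form:
  assumes moments: "\<And>i j. i < k \<Longrightarrow> j < k \<Longrightarrow> integrable P (\<lambda>\<omega>. x \<omega> $ i * x \<omega> $ j)"
    and u: "u \<in> carrier_vec k"
  shows "(\<integral>\<omega>. (x \<omega> \<bullet> u)\<^sup>2 \<partial>P) = u \<bullet> (second_moments P k x *\<^sub>v u)"
proof -
  have "(\<integral>\<omega>. (x \<omega> \<bullet> u)\<^sup>2 \<partial>P) = (\<integral>\<omega>. (\<Sum>i<k. \<Sum>j<k. (u $ i * u $ j) * (x \<omega> $ i * x \<omega> $ j)) \<partial>P)"
  proof (rule Bochner_Integration.integral_cong)
    fix \<omega>
    have "(x \<omega> \<bullet> u)\<^sup>2 = (\<Sum>i<k. x \<omega> $ i * u $ i) * (\<Sum>j<k. x \<omega> $ j * u $ j)"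
      using u by (simp add: power2_eq_square scalar_prod_def lessThan_atLeast0)
    then show "(x \<omega> \<bullet> u)\<^sup>2 = (\<Sum>i<k. \<Sum>j<k. (u $ i * u $ j) * (x \<omega> $ i * x \<omega> $ j))"
      by (simp add: sum_product mult_ac)
  qed simp
  also have "\<dots> = (\<Sum>i<k. \<Sum>j<k. (u $ i * u $ j) * (\<integral>\<omega>. x \<omega> $ i * x \<omega> $ j \<partial>P))"
    by (subst Bochner_Integration.integral_sum)
      (auto intro!: sum.cong Bochner_Integration.integrable_sum simp: moments Bochner_Integration.integral_sum)
  also have "\<dots> = u \<bullet> (second_moments P k x *\<^sub>v u)"
    using u by (simp add: second_moments_def scalar_prod_def lessThan_atLeast0 sum_distrib_left mult_ac)
  finally show ?thesis .
qed

lemma scalar_prod_diagonal: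
  fixes G :: "real mat"
  assumes G: "G \<in> carrier_mat k k" "diagonal_mat G" and d: "d \<in> carrier_vec k"
  shows "d \<bullet> (G *\<^sub>v d) = (\<Sum>i<k. G $$ (i, i) * (d $ i)\<^sup>2)"
proof -
  have "(G *\<^sub>v d) $ i = G $$ (i, i) * d $ i" if "i < k" for i
    by (subst diagonal_mat_eq_mat_diag[OF G]) (rule mat_diag_mult_vec[OF d that])
  moreover have "d \<bullet> (G *\<^sub>v d) = (\<Sum>i<k. d $ i * (G *\<^sub>v d) $ i)"
    using G by (simp add: scalar_prod_def lessThan_atLeast0)
  ultimately show ?thesis by (simp add: power2_eq_square mult_ac)
qed

definition weighted_average :: "nat \<Rightarrow> nat vec set \<Rightarrow> (nat vec \<Rightarrow> real) \<Rightarrow> (nat vec \<Rightarrow> real vec) \<Rightarrow> real vec" where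
  "weighted_average k L p u = vec k (\<lambda>i. \<Sum>l\<in>L. p l * u l $ i)"

lemma weighted_average_carrier[simp]: "weighted_average k L p u \<in> carrier_vec k"
  by (simp add: weighted_average_def)

lemma scalar_prod_weighted_average:
  assumes u: "\<And>l. l \<in> L \<Longrightarrow> u l \<in> carrier_vec k"
  shows "x \<bullet> weighted_average k L p u = (\<Sum>l\<in>L. p l * (x \<bullet> u l))"
proof -
  have "x \<bullet> weighted_average k L p u = (\<Sum>i<k. \<Sum>l\<in>L. p l * (x $ i * u l $ i))"
    by (simp add: scalar_prod_def weighted_average_def lessThan_atLeast0 sum_distrib_left mult_ac)
  also have "\<dots> = (\<Sum>l\<in>L. \<Sum>i<k. p l * (x $ i * u l $ i))" by (rule sum.swap)
  also have "\<dots> = (\<Sum>l\<in>L. p l * (x \<bullet> u l))"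
    by (intro sum.cong) (simp_all add: scalar_prod_def lessThan_atLeast0 sum_distrib_left carrier_vecD[OF u])
  finally show ?thesis .
qed

lemma mult_mat_weighted_average:
  assumes A: "A \<in> carrier_mat m k" and u: "\<And>l. l \<in> L \<Longrightarrow> u l \<in> carrier_vec k"
  shows "A *\<^sub>v weighted_average k L p u = weighted_average m L p (\<lambda>l. A *\<^sub>v u l)"
proof (rule eq_vecI)
  fix i assume "i < dim_vec (weighted_average m L p (\<lambda>l. A *\<^sub>v u l))"
  then have i: "i < m" by (simp add: weighted_average_def)
  then show "(A *\<^sub>v weighted_average k L p u) $ i = weighted_average m L p (\<lambda>l. A *\<^sub>v u l) $ i"
    using A scalar_prod_weighted_average[OF u, where x = "row A i" and L = L and p = p] by (simp add: weighted_average_def)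
qed (use A in \<open>simp add: weighted_average_def\<close>)

lemma predictor_scalar_prod:
  assumes "x \<in> carrier_vec (k1 + k2)" "bt1 l \<in> carrier_vec k1" "l \<in> carrier_vec k2"
  shows "predictor bt1 bt l x = x \<bullet> (bt1 l @\<^sub>v (selection_mat l *\<^sub>v bt l))"
proof -
  have w: "selection_mat l *\<^sub>v bt l \<in> carrier_vec k2"
    by (rule carrier_vecI) (simp add: selection_mat_def carrier_vecD[OF assms(3)])
  have "x \<bullet> (bt1 l @\<^sub>v (selection_mat l *\<^sub>v bt l))
      = (vec_first x k1 @\<^sub>v vec_last x k2) \<bullet> (bt1 l @\<^sub>v (selection_mat l *\<^sub>v bt l))"
    using assms(1) by simp
  also have "\<dots> = vec_first x k1 \<bullet> bt1 l + vec_last x k2 \<bullet> (selection_mat l *\<^sub>v bt l)"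
    by (rule scalar_prod_append[OF vec_first_carrier vec_last_carrier assms(2) w])
  finally show ?thesis using assms by (simp add: predictor_def)
qed

text \<open>The risk is the second moment form at the difference between the coefficients of the model and the
  averaged coefficients. Since the second moments are proportional to the Gram matrix of the design,
  it is \<open>\<gamma>\<close> times a squared distance of fitted values.\<close>

lemma predictive_risk_norm:
  fixes bt1 bt :: "nat vec \<Rightarrow> real vec" and p :: "nat vec \<Rightarrow> real"
  assumes X1: "X1 \<in> carrier_mat n k1" and X2: "X2 \<in> carrier_mat n k2"
    and L: "L \<subseteq> models k2" and l: "l \<in> L"
    and bt1: "\<And>l. l \<in> L \<Longrightarrow> bt1 l \<in> carrier_vec k1"
    and x: "\<And>\<omega>. \<omega> \<in> space P \<Longrightarrow> x \<omega> \<in> carrier_vec (k1 + k2)"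
    and moments: "\<And>i j. i < k1 + k2 \<Longrightarrow> j < k1 + k2 \<Longrightarrow> integrable P (\<lambda>\<omega>. x \<omega> $ i * x \<omega> $ j)"
    and Q: "second_moments P (k1 + k2) x = \<gamma> \<cdot>\<^sub>m (transpose_mat (full_design X1 X2) * full_design X1 X2)"
  defines "w \<equiv> \<lambda>l. selection_mat l *\<^sub>v bt l"
  defines "e \<equiv> X1 *\<^sub>v (bt1 l - weighted_average k1 L p bt1) + X2 *\<^sub>v (w l - weighted_average k2 L p w)"
  shows "predictive_risk P x L p bt1 bt l = \<gamma> * (e \<bullet> e)"
proof -
  let ?k = "k1 + k2" and ?F = "full_design X1 X2"
  define u where "u = (\<lambda>l. bt1 l @\<^sub>v w l)"
  define d where "d = u l - weighted_average ?k L p u"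
  have w: "w l \<in> carrier_vec k2" if "l \<in> L" for l
    using modelsD(1)[of l k2] L that by (intro carrier_vecI) (auto simp: w_def selection_mat_def)
  have u: "u l \<in> carrier_vec ?k" if "l \<in> L" for l
    using bt1[OF that] w[OF that] by (simp add: u_def)
  have d: "d \<in> carrier_vec ?k" using u[OF l] by (simp add: d_def)
  have pred: "predictor bt1 bt l' (x \<omega>) = x \<omega> \<bullet> u l'" if "\<omega> \<in> space P" "l' \<in> L" for \<omega> l'
    unfolding u_def w_def using x[OF that(1)] bt1[OF that(2)] modelsD(2)[of l' k2] L that(2)
    by (intro predictor_scalar_prod) auto
  have "predictive_risk P x L p bt1 bt l = (\<integral>\<omega>. (x \<omega> \<bullet> d)\<^sup>2 \<partial>P)"
    unfolding predictive_risk_def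
  proof (rule Bochner_Integration.integral_cong)
    fix \<omega> assume \<omega>: "\<omega> \<in> space P"
    have "averaged_predictor L p bt1 bt (x \<omega>) = x \<omega> \<bullet> weighted_average ?k L p u"
      unfolding averaged_predictor_def
      by (subst scalar_prod_weighted_average) (auto simp: u pred[OF \<omega>] intro!: sum.cong)
    then show "(predictor bt1 bt l (x \<omega>) - averaged_predictor L p bt1 bt (x \<omega>))\<^sup>2 = (x \<omega> \<bullet> d)\<^sup>2"
      using pred[OF \<omega> l] scalar_prod_minus_distrib[OF x[OF \<omega>] u[OF l] weighted_average_carrier]
      by (simp add: d_def)
  qed simp
  also have "\<dots> = \<gamma> * ((?F *\<^sub>v d) \<bullet> (?F *\<^sub>v d))"
    unfolding scalar_prod_scaled_gram[OF full_design_carrier[OF X1 X2] d, symmetric] Q[symmetric]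
    by (rule second_moments_quadratic_form[OF moments d])
  also have "d = (bt1 l - weighted_average k1 L p bt1) @\<^sub>v (w l - weighted_average k2 L p w)"
    (is "_ = ?r")
  proof (rule eq_vecI)
    fix i assume "i < dim_vec ?r"
    then have i: "i < ?k" by (simp add: weighted_average_def)
    have idx: "u l' $ i = (if i < k1 then bt1 l' $ i else w l' $ (i - k1))" if "l' \<in> L" for l'
      using bt1[OF that] w[OF that] i by (simp add: u_def)
    have avg: "weighted_average ?k L p u $ i
        = (if i < k1 then weighted_average k1 L p bt1 $ i else weighted_average k2 L p w $ (i - k1))"
      using i by (auto simp: weighted_average_def idx intro!: sum.cong)
    show "d $ i = ?r $ i"
      using i bt1[OF l] w[OF l] idx[OF l] avg u[OF l] by (simp add: d_def weighted_average_carrier[THEN carrier_vecD])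
  qed (use d in \<open>simp add: weighted_average_def\<close>)
  also have "?F *\<^sub>v ?r = e"
    unfolding e_def by (rule full_design_mult_append[OF X1 X2]) (use bt1[OF l] w[OF l] in auto)
  finally show ?thesis .
qed

text \<open>The posterior means of the common coefficients differ between models only through what the
  noncommon coefficients leave to be fitted: they differ by minus \<open>least_squares\<close> applied to \<open>X2\<close> times the
  difference of the noncommon coefficients. So adjusting the common coefficients replaces the fitted
  difference \<open>X2 *\<^sub>v d\<close> by its residual, whose squared norm is a diagonal quadratic form in \<open>d\<close>. Averaging
  over the models preserves this affine relation because the weights sum to 1.\<close>

lemma (in injective_design) predictive_risk_eq_weighted_squares:
  assumes X2: "X2 \<in> carrier_mat n k2" and y: "y \<in> carrier_vec n"
    and L: "L \<subseteq> models k2" and l: "l \<in> L" and p_sum: "(\<Sum>l\<in>L. p l) = 1"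
    and bt1: "\<And>l. l \<in> L \<Longrightarrow> bt1 l = least_squares *\<^sub>v (y - X2 *\<^sub>v (selection_mat l *\<^sub>v bt l))"
    and x: "\<And>\<omega>. \<omega> \<in> space P \<Longrightarrow> x \<omega> \<in> carrier_vec (k1 + k2)"
    and moments: "\<And>i j. i < k1 + k2 \<Longrightarrow> j < k1 + k2 \<Longrightarrow> integrable P (\<lambda>\<omega>. x \<omega> $ i * x \<omega> $ j)"
    and Q: "second_moments P (k1 + k2) x = \<gamma> \<cdot>\<^sub>m (transpose_mat (full_design X1 X2) * full_design X1 X2)"
    and diag: "diagonal_mat (transpose_mat X2 * residual_proj X1 * X2)"
  shows "predictive_risk P x L p bt1 bt l = \<gamma> * (\<Sum>i<k2. (transpose_mat X2 * residual_proj X1 * X2) $$ (i, i)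
      * ((selection_mat l *\<^sub>v bt l) $ i - (\<Sum>l\<in>L. p l * (selection_mat l *\<^sub>v bt l) $ i))\<^sup>2)"
proof -
  define w where "w = (\<lambda>l. selection_mat l *\<^sub>v bt l)"
  define C where "C = least_squares * X2"
  define G where "G = transpose_mat X2 * residual_proj X1 * X2"
  define d where "d = w l - weighted_average k2 L p w"
  have C: "C \<in> carrier_mat k1 k2" using least_squares_carrier X2 by (auto simp: C_def)
  have G: "G \<in> carrier_mat k2 k2" using residual_proj_carrier X2 by (auto simp: G_def)
  have w: "w l \<in> carrier_vec k2" if "l \<in> L" for l
    using modelsD(1)[of l k2] L that by (intro carrier_vecI) (auto simp: w_def selection_mat_def)
  have d: "d \<in> carrier_vec k2" using w[OF l] by (simp add: d_def)
  have X2d: "X2 *\<^sub>v d \<in> carrier_vec n" using X2 d by auto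
  have lsy: "least_squares *\<^sub>v y \<in> carrier_vec k1" by (rule least_squares_vec_carrier[OF y])
  have w_app: "selection_mat l *\<^sub>v bt l = w l" for l by (simp only: w_def)
  have bt1_eq: "bt1 l = least_squares *\<^sub>v y - C *\<^sub>v w l" if "l \<in> L" for l
    using least_squares_carrier X2 y w[OF that] bt1[OF that] w_app[of l]
    by (simp add: C_def mult_minus_distrib_mat_vec[of _ k1 n] mult_mat_vec_assoc)
  have Cw: "C *\<^sub>v v \<in> carrier_vec k1" for v using C by (intro carrier_vecI) simp
  have bt1_carrier: "bt1 l \<in> carrier_vec k1" if "l \<in> L" for l
    unfolding bt1_eq[OF that] using lsy Cw by auto
  have Cavg: "C *\<^sub>v weighted_average k2 L p w = weighted_average k1 L p (\<lambda>l. C *\<^sub>v w l)"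
    by (rule mult_mat_weighted_average[OF C w])
  have avg: "weighted_average k1 L p bt1 = least_squares *\<^sub>v y - C *\<^sub>v weighted_average k2 L p w"
  proof (rule eq_vecI)
    fix i assume "i < dim_vec (least_squares *\<^sub>v y - C *\<^sub>v weighted_average k2 L p w)"
    then have i: "i < k1" using C by simp
    have "weighted_average k1 L p bt1 $ i = (\<Sum>l\<in>L. p l * (least_squares *\<^sub>v y) $ i - p l * (C *\<^sub>v w l) $ i)"
      unfolding weighted_average_def index_vec[OF i]
    proof (rule sum.cong)
      fix l' assume l': "l' \<in> L"
      have "bt1 l' $ i = (least_squares *\<^sub>v y) $ i - (C *\<^sub>v w l') $ i"
        unfolding bt1_eq[OF l'] using i C by (simp del: index_mult_mat_vec)
      then show "p l' * bt1 l' $ i = p l' * (least_squares *\<^sub>v y) $ i - p l' * (C *\<^sub>v w l') $ i"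
        by (simp only: right_diff_distrib)
    qed simp
    also have "\<dots> = (least_squares *\<^sub>v y) $ i - weighted_average k1 L p (\<lambda>l. C *\<^sub>v w l) $ i"
      unfolding sum_subtractf sum_distrib_right[symmetric] p_sum using i by (simp add: weighted_average_def)
    also have "\<dots> = (least_squares *\<^sub>v y - C *\<^sub>v weighted_average k2 L p w) $ i"
      unfolding Cavg using i by (simp add: weighted_average_def)
    finally show "weighted_average k1 L p bt1 $ i = (least_squares *\<^sub>v y - C *\<^sub>v weighted_average k2 L p w) $ i" .
  qed (use C in \<open>simp add: weighted_average_def\<close>)
  have "bt1 l - weighted_average k1 L p bt1 = - (C *\<^sub>v d)"
    unfolding bt1_eq[OF l] avg d_def mult_minus_distrib_mat_vec[OF C w[OF l] weighted_average_carrier]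
    using lsy C by (intro eq_vecI) (auto simp del: index_mult_mat_vec)
  also have "\<dots> = - (least_squares *\<^sub>v (X2 *\<^sub>v d))"
    using least_squares_carrier X2 d by (simp add: C_def mult_mat_vec_assoc)
  finally have "X1 *\<^sub>v (bt1 l - weighted_average k1 L p bt1) + X2 *\<^sub>v d
      = X1 *\<^sub>v (- (least_squares *\<^sub>v (X2 *\<^sub>v d))) + X2 *\<^sub>v d" by (simp only:)
  also have "\<dots> = residual_proj X1 *\<^sub>v (X2 *\<^sub>v d)"
  proof -
    have "X1 *\<^sub>v (- (least_squares *\<^sub>v (X2 *\<^sub>v d))) = - (X1 *\<^sub>v (least_squares *\<^sub>v (X2 *\<^sub>v d)))"
      using X1 least_squares_vec_carrier[OF X2d] by (intro eq_vecI) (auto simp: scalar_prod_def sum_negf)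
    then show ?thesis
      unfolding residual_proj_mult_vec[OF X2d] using X1 X2 by (intro eq_vecI) (auto simp del: index_mult_mat_vec)
  qed
  finally have e: "X1 *\<^sub>v (bt1 l - weighted_average k1 L p bt1) + X2 *\<^sub>v d = residual_proj X1 *\<^sub>v (X2 *\<^sub>v d)" .
  have "predictive_risk P x L p bt1 bt l = \<gamma> * ((residual_proj X1 *\<^sub>v (X2 *\<^sub>v d)) \<bullet> (residual_proj X1 *\<^sub>v (X2 *\<^sub>v d)))"
    unfolding e[symmetric] unfolding d_def w_def
    by (rule predictive_risk_norm[OF X1 X2 L l bt1_carrier x moments Q])
  also have "\<dots> = \<gamma> * ((X2 *\<^sub>v d) \<bullet> (residual_proj X1 *\<^sub>v (X2 *\<^sub>v d)))"
    by (simp only: residual_norm[OF X2d])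
  also have "(X2 *\<^sub>v d) \<bullet> (residual_proj X1 *\<^sub>v (X2 *\<^sub>v d)) = d \<bullet> (G *\<^sub>v d)"
  proof -
    have R: "residual_proj X1 *\<^sub>v (X2 *\<^sub>v d) \<in> carrier_vec n" using residual_proj_carrier X2d by auto
    have X2tR: "transpose_mat X2 *\<^sub>v (residual_proj X1 *\<^sub>v (X2 *\<^sub>v d)) \<in> carrier_vec k2" using X2 R by auto
    have "(X2 *\<^sub>v d) \<bullet> (residual_proj X1 *\<^sub>v (X2 *\<^sub>v d)) = (residual_proj X1 *\<^sub>v (X2 *\<^sub>v d)) \<bullet> (X2 *\<^sub>v d)"
      by (rule comm_scalar_prod[OF X2d R])
    also have "\<dots> = (transpose_mat X2 *\<^sub>v (residual_proj X1 *\<^sub>v (X2 *\<^sub>v d))) \<bullet> d"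
      by (rule transpose_vec_mult_scalar[OF X2 d R, symmetric])
    also have "\<dots> = d \<bullet> (transpose_mat X2 *\<^sub>v (residual_proj X1 *\<^sub>v (X2 *\<^sub>v d)))"
      by (rule comm_scalar_prod[OF X2tR d])
    also have "transpose_mat X2 *\<^sub>v (residual_proj X1 *\<^sub>v (X2 *\<^sub>v d)) = G *\<^sub>v d"
      using X2 d residual_proj_carrier by (simp add: G_def mult_mat_vec_assoc)
    finally show ?thesis .
  qed
  also have "d \<bullet> (G *\<^sub>v d) = (\<Sum>i<k2. G $$ (i, i) * (d $ i)\<^sup>2)"
    by (rule scalar_prod_diagonal[OF G _ d]) (use diag in \<open>simp add: G_def\<close>)
  also have "\<dots> = (\<Sum>i<k2. G $$ (i, i) * (w l $ i - (\<Sum>l\<in>L. p l * w l $ i))\<^sup>2)"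
    using w[OF l] by (intro sum.cong) (auto simp: d_def weighted_average_def)
  finally show ?thesis by (simp only: w_def G_def)
qed

lemma noncommon_coefficients_index:
  fixes R :: "real mat"
  assumes X2: "X2 \<in> carrier_mat n k2" and R: "R \<in> carrier_mat n n" and y: "y \<in> carrier_vec n"
    and l: "l \<in> models k2"
    and diag: "diagonal_mat (transpose_mat X2 * R * X2)"
      "\<And>i. i < k2 \<Longrightarrow> 0 < (transpose_mat X2 * R * X2) $$ (i, i)"
    and bt: "bt = b \<cdot>\<^sub>v (inv_mat (transpose_mat (sub_design X2 l) * R * sub_design X2 l)
               *\<^sub>v (transpose_mat (sub_design X2 l) *\<^sub>v (R *\<^sub>v y)))"
    and i: "i < k2"
  shows "(selection_mat l *\<^sub>v bt) $ i
    = real (l $ i) * (b * (transpose_mat X2 *\<^sub>v (R *\<^sub>v y)) $ i / (transpose_mat X2 * R * X2) $$ (i, i))"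
proof -
  let ?G = "transpose_mat X2 * R * X2" and ?H = "selection_mat l"
  let ?v = "transpose_mat X2 *\<^sub>v (R *\<^sub>v y)"
  let ?s = "inv_mat (transpose_mat ?H * ?G * ?H) *\<^sub>v (transpose_mat ?H *\<^sub>v ?v)"
  have H: "?H \<in> carrier_mat k2 (model_size l)"
    using selection_mat_carrier[of l] modelsD(1)[OF l] by simp
  have G: "?G \<in> carrier_mat k2 k2" using X2 R by auto
  have v: "?v \<in> carrier_vec k2" using X2 R y by auto
  have tr: "transpose_mat (X2 * ?H) = transpose_mat ?H * transpose_mat X2"
    by (rule transpose_mult[OF X2 H])
  have "bt = b \<cdot>\<^sub>v ?s"
    unfolding bt sub_design_def tr using X2 H R y by (simp add: mult_mat_assoc mult_mat_vec_assoc)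
  moreover have "?s \<in> carrier_vec (model_size l)"
    using H by (intro carrier_vecI) (simp add: inv_mat_selected_diagonal[OF l G diag])
  ultimately have "(?H *\<^sub>v bt) $ i = b * (?H *\<^sub>v ?s) $ i"
    using H i by (simp add: mult_mat_vec[OF H] del: index_mult_mat_vec)
  also have "(?H *\<^sub>v ?s) $ i = real (l $ i) * ?v $ i / ?G $$ (i, i)"
    by (rule selected_diagonal_solution[OF l G diag v i])
  finally show ?thesis by simp
qed

section \<open>The median probability model\<close>

text \<open>If \<open>x\<^sub>i\<close> forces \<open>x\<^sub>j\<close>, every model with \<open>x\<^sub>i\<close> also has \<open>x\<^sub>j\<close>, so the inclusion probability of \<open>x\<^sub>j\<close> is at
  least that of \<open>x\<^sub>i\<close> and reaches one half whenever the latter does. A common variable counts as having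
  inclusion probability 1.\<close>

lemma median_probability_model_in_class:
  assumes graphical: "graphical_structure k1 k2 L"
    and p_nonneg: "\<And>l. l \<in> L \<Longrightarrow> 0 \<le> p l" and p_sum: "(\<Sum>l\<in>L. p l) = 1"
  shows "median_probability_model k2 L p \<in> L"
proof -
  let ?m = "median_probability_model k2 L p"
  obtain I where I: "\<And>i. i < k1 + k2 \<Longrightarrow> I i \<subseteq> {..<k1 + k2} - {i}"
    and L: "L = {l \<in> models k2. \<forall>i < k1 + k2. i \<in> model_variables k1 l \<longrightarrow> I i \<subseteq> model_variables k1 l}"
    using graphical unfolding graphical_structure_def by blast
  have fin: "finite L" using p_sum sum.infinite by fastforce
  have m: "?m \<in> models k2" by (simp add: median_probability_model_def models_def)
  have common: "i \<in> model_variables k1 l \<longleftrightarrow> i < k1 \<or> (\<exists>j<k2. i = k1 + j \<and> l $ j = 1)" if "l \<in> models k2" for l i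
    using modelsD(1)[OF that] by (auto simp: model_variables_def)
  have half: "1/2 \<le> inclusion_prob L p j"
    if all: "\<And>l. l \<in> L \<Longrightarrow> P l \<Longrightarrow> l $ j = 1" and P: "1/2 \<le> (\<Sum>l\<in>{l\<in>L. P l}. p l)" for j P
  proof -
    have "(\<Sum>l\<in>{l\<in>L. P l}. p l) \<le> inclusion_prob L p j"
      unfolding inclusion_prob_def using all p_nonneg fin by (intro sum_mono2) auto
    with P show ?thesis by linarith
  qed
  have "j \<in> model_variables k1 ?m"
    if i: "i < k1 + k2" "i \<in> model_variables k1 ?m" and j: "j \<in> I i" for i j
  proof (cases "j < k1")
    case True
    then show ?thesis using common[OF m] by simp
  next
    case False
    then obtain j' where j': "j = k1 + j'" "j' < k2"
      using I[OF i(1)] j by (metis DiffD1 lessThan_iff less_diff_conv2 le_add_diff_inverse linorder_not_le nat_add_left_cancel_less subsetD)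
    have implied: "l $ j' = 1" if "l \<in> L" "i \<in> model_variables k1 l" for l
      using that j j' i(1) common[of l j] unfolding L by auto
    have "1/2 \<le> inclusion_prob L p j'"
    proof (rule half[where P = "\<lambda>l. i \<in> model_variables k1 l"], rule implied; assumption?)
      show "1/2 \<le> (\<Sum>l\<in>{l\<in>L. i \<in> model_variables k1 l}. p l)"
      proof (cases "i < k1")
        case True
        then have "{l\<in>L. i \<in> model_variables k1 l} = L" using common L by auto
        then show ?thesis using p_sum by simp
      next
        case False
        then obtain i' where i': "i = k1 + i'" "i' < k2" "?m $ i' = 1" using i(2) common[OF m] by auto
        then have "1/2 \<le> inclusion_prob L p i'"
          by (auto simp: median_probability_model_def split: if_splits)
        moreover have "{l\<in>L. i \<in> model_variables k1 l} = {l\<in>L. l $ i' = 1}"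
          using i' common L by auto
        ultimately show ?thesis by (simp add: inclusion_prob_def)
      qed
    qed
    then have "?m $ j' = 1" using j' by (simp add: median_probability_model_def)
    then show ?thesis using j' common[OF m] by simp
  qed
  then show ?thesis using m by (subst L) blast
qed

text \<open>The sum is minimized term by term: of 0 and 1, the value nearer to \<open>p\<^sub>i\<close> is 1 exactly if
  \<open>p\<^sub>i \<ge> 1/2\<close>, up to ties.\<close>

lemma median_minimizes_weighted_squares:
  assumes weight: "\<And>i. i < k2 \<Longrightarrow> 0 \<le> c i" and l: "l \<in> models k2"
  shows "(\<Sum>i<k2. c i * (real (median_probability_model k2 L p $ i) - inclusion_prob L p i)\<^sup>2)
    \<le> (\<Sum>i<k2. c i * (real (l $ i) - inclusion_prob L p i)\<^sup>2)"
proof (rule sum_mono)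
  fix i assume "i \<in> {..<k2}"
  then have i: "i < k2" by simp
  have "(real (median_probability_model k2 L p $ i) - inclusion_prob L p i)\<^sup>2 \<le> (real (l $ i) - inclusion_prob L p i)\<^sup>2"
    using modelsD(3)[OF l i] i by (auto simp: median_probability_model_def power2_eq_square algebra_simps)
  then show "c i * (real (median_probability_model k2 L p $ i) - inclusion_prob L p i)\<^sup>2
      \<le> c i * (real (l $ i) - inclusion_prob L p i)\<^sup>2"
    using weight[OF i] by (rule mult_left_mono)
qed

theorem corollary3:
  fixes n k1 k2 :: nat
    and X1 X2 Q :: "real mat" and y :: "real vec"
    and L :: "nat vec set" and p :: "nat vec \<Rightarrow> real"
    and \<pi> :: "nat vec \<Rightarrow> real vec \<Rightarrow> real vec \<Rightarrow> real \<Rightarrow> real" and S :: "nat vec \<Rightarrow> real measure"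
    and bt1 bt :: "nat vec \<Rightarrow> real vec"
    and P :: "'w measure" and xs :: "'w \<Rightarrow> real vec"
    and \<gamma> b :: real
  assumes X1: "X1 \<in> carrier_mat n k1"
    and X2: "X2 \<in> carrier_mat n k2"
    and y: "y \<in> carrier_vec n"
    and size: "k1 + k2 < n"
    and full_rank: "vec_space.rank n (full_design X1 X2) = k1 + k2"
    and L: "L \<subseteq> models k2"
    and p_nonneg: "\<And>l. l \<in> L \<Longrightarrow> 0 \<le> p l"
    and p_sum: "(\<Sum>l\<in>L. p l) = 1"
    and sd_prior: "\<And>l. l \<in> L \<Longrightarrow> sd_prior (S l)"
    and prior: "\<And>l. l \<in> L \<Longrightarrow> prior_density X1 (sub_design X2 l) (\<pi> l) (S l)"
    and proper: "\<And>l. l \<in> L \<Longrightarrow> proper_posterior X1 (sub_design X2 l) y (\<pi> l) (S l)"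
    and means_exist: "\<And>l. l \<in> L \<Longrightarrow> has_coefficient_means k1 (model_size l)
           (posterior X1 (sub_design X2 l) y (\<pi> l) (S l))"
    and bt1: "\<And>l. l \<in> L \<Longrightarrow> bt1 l =
           mean_common k1 (posterior X1 (sub_design X2 l) y (\<pi> l) (S l))"
    and bt: "\<And>l. l \<in> L \<Longrightarrow> bt l =
           mean_noncommon (model_size l) (posterior X1 (sub_design X2 l) y (\<pi> l) (S l))"
    and P: "prob_space P"
    and xs: "\<And>\<omega>. \<omega> \<in> space P \<Longrightarrow> xs \<omega> \<in> carrier_vec (k1 + k2)"
    and xs_measurable: "\<And>i. i < k1 + k2 \<Longrightarrow> (\<lambda>\<omega>. xs \<omega> $ i) \<in> borel_measurable P"
    and xs_moments: "\<And>i j. i < k1 + k2 \<Longrightarrow> j < k1 + k2 \<Longrightarrow>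
           integrable P (\<lambda>\<omega>. xs \<omega> $ i * xs \<omega> $ j)"
    and Q: "Q = second_moments P (k1 + k2) xs"
    and Q_pos_def: "pos_def_mat Q"
    and cond1: "\<gamma> > 0" "Q = \<gamma> \<cdot>\<^sub>m (transpose_mat (full_design X1 X2) * full_design X1 X2)"
    and cond2: "b > 0"
      "\<And>l. l \<in> L \<Longrightarrow> bt l =
         b \<cdot>\<^sub>v (inv_mat (transpose_mat (sub_design X2 l) * residual_proj X1 * sub_design X2 l)
               *\<^sub>v (transpose_mat (sub_design X2 l) *\<^sub>v (residual_proj X1 *\<^sub>v y)))"
    and cond3: "\<And>l. l \<in> L \<Longrightarrow> \<exists>g :: real vec \<Rightarrow> real \<Rightarrow> real.
         \<forall>b1 \<in> carrier_vec k1. \<forall>bl \<in> carrier_vec (model_size l). \<forall>s > 0. \<pi> l b1 bl s = g bl s"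
    and diag: "diagonal_mat (transpose_mat X2 * residual_proj X1 * X2)"
      "\<And>i. i < k2 \<Longrightarrow> 0 < (transpose_mat X2 * residual_proj X1 * X2) $$ (i, i)"
    and graphical: "graphical_structure k1 k2 L"
  shows "best_predictive_model P xs L p bt1 bt (median_probability_model k2 L p)"
proof -
  interpret injective_design X1 n k1
    using injective_design_of_pos_def[OF X1 X2] Q_pos_def cond1(2) by simp
  let ?G = "transpose_mat X2 * residual_proj X1 * X2"
  let ?m = "median_probability_model k2 L p"
  let ?w = "\<lambda>l. selection_mat l *\<^sub>v bt l"
  (* The common value of coefficient i in all models that contain it. *)
  define a where "a i = b * (transpose_mat X2 *\<^sub>v (residual_proj X1 *\<^sub>v y)) $ i / ?G $$ (i, i)" for i
  have coefficients: "?w l $ i = real (l $ i) * a i" if "l \<in> L" "i < k2" for l i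
    unfolding a_def using noncommon_coefficients_index[OF X2 residual_proj_carrier y _ diag cond2(2)] that L
    by blast
  have common: "bt1 l = least_squares *\<^sub>v (y - X2 *\<^sub>v ?w l)" if l: "l \<in> L" for l
  proof -
    have H: "selection_mat l \<in> carrier_mat k2 (model_size l)"
      using selection_mat_carrier[of l] modelsD(1)[of l k2] L l by auto
    have Xl: "sub_design X2 l \<in> carrier_mat n (model_size l)"
      using X2 H by (auto simp: sub_design_def)
    have btl: "bt l \<in> carrier_vec (model_size l)" unfolding bt[OF l] by (simp add: mean_noncommon_def)
    from cond3[OF l] obtain g where g: "\<And>b1 bl s. b1 \<in> carrier_vec k1 \<Longrightarrow> bl \<in> carrier_vec (model_size l)
        \<Longrightarrow> 0 < s \<Longrightarrow> \<pi> l b1 bl s = g bl s" by blast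
    have "bt1 l = least_squares *\<^sub>v (y - sub_design X2 l *\<^sub>v bt l)"
      unfolding bt1[OF l] bt[OF l]
      by (rule mean_common_eq_least_squares[OF Xl y sd_prior[OF l] prior[OF l] proper[OF l] means_exist[OF l] g])
    also have "sub_design X2 l *\<^sub>v bt l = X2 *\<^sub>v ?w l"
      using X2 H btl by (simp add: sub_design_def mult_mat_vec_assoc)
    finally show ?thesis .
  qed
  have risk: "predictive_risk P xs L p bt1 bt l
      = \<gamma> * (\<Sum>i<k2. (?G $$ (i, i) * (a i)\<^sup>2) * (real (l $ i) - inclusion_prob L p i)\<^sup>2)" if l: "l \<in> L" for l
  proof -
    have avg: "(\<Sum>l\<in>L. p l * ?w l $ i) = inclusion_prob L p i * a i" if i: "i < k2" for i
    proof -
      have fin: "finite L" using p_sum sum.infinite by fastforce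
      have "(\<Sum>l\<in>L. p l * ?w l $ i) = (\<Sum>l\<in>L. if l $ i = 1 then p l * a i else 0)"
      proof (rule sum.cong)
        fix l assume l: "l \<in> L"
        then have "l $ i = 0 \<or> l $ i = 1" using modelsD(3)[of l k2 i] L i by blast
        then show "p l * ?w l $ i = (if l $ i = 1 then p l * a i else 0)"
          using coefficients[OF l i] by auto
      qed simp
      also have "\<dots> = inclusion_prob L p i * a i"
        unfolding inclusion_prob_def sum_distrib_right using fin by (rule sum.inter_filter[symmetric])
      finally show ?thesis .
    qed
    have term_eq: "?G $$ (i, i) * (?w l $ i - (\<Sum>l\<in>L. p l * ?w l $ i))\<^sup>2
        = (?G $$ (i, i) * (a i)\<^sup>2) * (real (l $ i) - inclusion_prob L p i)\<^sup>2" if "i < k2" for i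
      unfolding coefficients[OF l that] avg[OF that] left_diff_distrib[symmetric] power_mult_distrib
      by (simp only: mult_ac)
    have "predictive_risk P xs L p bt1 bt l
        = \<gamma> * (\<Sum>i<k2. ?G $$ (i, i) * (?w l $ i - (\<Sum>l\<in>L. p l * ?w l $ i))\<^sup>2)"
      by (rule predictive_risk_eq_weighted_squares[OF X2 y L l p_sum common xs xs_moments _ diag(1)])
        (use Q cond1(2) in simp_all)
    also have "\<dots> = \<gamma> * (\<Sum>i<k2. (?G $$ (i, i) * (a i)\<^sup>2) * (real (l $ i) - inclusion_prob L p i)\<^sup>2)"
      by (intro arg_cong[of _ _ "\<lambda>s. \<gamma> * s"] sum.cong refl term_eq) simp
    finally show ?thesis .
  qed
  have m: "?m \<in> L" by (rule median_probability_model_in_class[OF graphical p_nonneg p_sum])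
  have "predictive_risk P xs L p bt1 bt ?m \<le> predictive_risk P xs L p bt1 bt l" if l: "l \<in> L" for l
    unfolding risk[OF m] risk[OF l]
  proof (rule mult_left_mono[OF median_minimizes_weighted_squares])
    show "l \<in> models k2" using L l by blast
    show "0 \<le> ?G $$ (i, i) * (a i)\<^sup>2" if "i < k2" for i using diag(2)[OF that] by simp
  qed (use cond1(1) in simp)
  with m show ?thesis
    unfolding best_predictive_model_def is_arg_min_def by (auto simp: not_less)
qed

end
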